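(* Let $\beta>0$, let $\mu$ be the semicircle law $\mu(d\lambda)=\frac{1}{2\pi\beta^2}\sqrt{4\beta^2-\lambda^2}\,1_{[-2\beta,2\beta]}(\lambda)\,d\lambda$, and let $\nu$ be any compactly supported probability measure on $\mathbb{R}$. Then for all real $z<z^*_{\mu\boxplus\nu}$, $$U_{\mu\boxplus\nu}(z)=\inf_{g\in(0,g^*_{\mu\boxplus\nu}):\ \beta^2g<\operatorname{supp}_-\nu-z}\left\{\frac{\beta^2g^2}{2}+\int\log(\lambda-z-\beta^2g)\,\nu(d\lambda)\right\}.$$
   Context: $\mu\boxplus\nu$ denotes the free additive convolution of the compactly supported probability measures $\mu,\nu$ on $\mathbb{R}$. For a compactly supported probability measure $\rho$ on $\mathbb{R}$, $\operatorname{supp}_-\rho$ is the infimum of its support, $U_\rho(z)=\int\log|z-\lambda|\,\rho(d\lambda)$ is its logarithmic potential, and $G_\rho(z)=\int\frac{\rho(d\lambda)}{\lambda-z}$ is its Stieltjes transform (note the sign). $z^*_{\mu\boxplus\nu}=\operatorname{supp}_-(\mu\boxplus\nu)$ and $g^*_{\mu\boxplus\nu}=\lim_{z\uparrow z^*_{\mu\boxplus\nu}}G_{\mu\boxplus\nu}(z)\in(0,\infty]$. *)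

theory Defs
  imports "HOL-Probability.Probability" "HOL-Library.Poly_Mapping"
begin

section \<open>Compactly supported probability measures on the real line\<close>

definition msupport :: "real measure \<Rightarrow> real set" where
  "msupport M = {x. \<forall>U. open U \<longrightarrow> x \<in> U \<longrightarrow> emeasure M U > 0}"

definition compactly_supported_distribution :: "real measure \<Rightarrow> bool" where
  "compactly_supported_distribution M \<longleftrightarrow> real_distribution M \<and> compact (msupport M)"

definition supp_minus :: "real measure \<Rightarrow> real" where
  "supp_minus M = Inf (msupport M)"

definition log_potential :: "real measure \<Rightarrow> real \<Rightarrow> real" where
  "log_potential M z = (LINT l|M. ln \<bar>z - l\<bar>)"

definition stieltjes :: "real measure \<Rightarrow> real \<Rightarrow> real" where
  "stieltjes M z = (LINT l|M. 1 / (l - z))"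

text \<open>The limit is taken in the extended reals, since it may be \<open>\<infinity>\<close>.\<close>

definition g_star :: "real measure \<Rightarrow> ereal" where
  "g_star M = Lim (at_left (supp_minus M)) (\<lambda>z. ereal (stieltjes M z))"

definition semicircle :: "real \<Rightarrow> real measure" where
  "semicircle \<beta> = density lborel (\<lambda>x. ennreal
     (1 / (2 * pi * \<beta>\<^sup>2) * sqrt (4 * \<beta>\<^sup>2 - x\<^sup>2) * indicator {- 2 * \<beta> .. 2 * \<beta>} x))"

section \<open>Noncommutative polynomials in two variables\<close>

text \<open>
  Words in two letters form the free monoid on two generators. It is written additively, with
  concatenation as addition, because \<open>Poly_Mapping\<close> builds monoid algebras over additive monoids;
  the convolution product on \<open>nc_poly\<close> is then that of the free complex algebra.
\<close>

datatype word = Word (letters: "bool list")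

instantiation word :: monoid_add
begin

definition zero_word :: word where
  "0 = Word []"

definition plus_word :: "word \<Rightarrow> word \<Rightarrow> word" where
  "u + v = Word (letters u @ letters v)"

instance
  by standard (simp_all add: zero_word_def plus_word_def)

end

type_synonym nc_poly = "word \<Rightarrow>\<^sub>0 complex"

definition nc_const :: "complex \<Rightarrow> nc_poly" where
  "nc_const c = Poly_Mapping.single 0 c"

definition nc_var :: "bool \<Rightarrow> nc_poly" where
  "nc_var i = Poly_Mapping.single (Word [i]) 1"

definition unital_functional :: "(nc_poly \<Rightarrow> complex) \<Rightarrow> bool" where
  "unital_functional \<phi> \<longleftrightarrow>
     (\<forall>x y. \<phi> (x + y) = \<phi> x + \<phi> y) \<and> (\<forall>c x. \<phi> (nc_const c * x) = c * \<phi> x) \<and> \<phi> 1 = 1"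

definition generated_subalgebra :: "nc_poly \<Rightarrow> nc_poly set" where
  "generated_subalgebra a = {(\<Sum>k\<le>n. nc_const (c k) * a ^ k) | (n :: nat) c. True}"

section \<open>Freeness and free additive convolution\<close>

text \<open>Alternating products of centred elements are centred.\<close>

definition freely_independent :: "(nc_poly \<Rightarrow> complex) \<Rightarrow> ('i \<Rightarrow> nc_poly set) \<Rightarrow> bool" where
  "freely_independent \<phi> A \<longleftrightarrow>
     (\<forall>ws :: ('i \<times> nc_poly) list.
        ws \<noteq> [] \<longrightarrow> (\<forall>(i, x) \<in> set ws. x \<in> A i \<and> \<phi> x = 0) \<longrightarrow> distinct_adj (map fst ws) \<longrightarrow>
        \<phi> (prod_list (map snd ws)) = 0)"

definition has_law :: "(nc_poly \<Rightarrow> complex) \<Rightarrow> nc_poly \<Rightarrow> real measure \<Rightarrow> bool" where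
  "has_law \<phi> a M \<longleftrightarrow> (\<forall>n. \<phi> (a ^ n) = complex_of_real (LINT x|M. x ^ n))"

text \<open>
  \<open>free_additive_convolution \<mu> \<nu> \<rho>\<close> says that \<open>\<rho>\<close> is the measure \<open>\<mu> \<boxplus> \<nu>\<close>, that is, the law of
  \<open>a + b\<close> for free random variables \<open>a\<close>, \<open>b\<close> with laws \<open>\<mu>\<close>, \<open>\<nu>\<close>. Pulling a functional back along
  \<open>X \<mapsto> a\<close>, \<open>Y \<mapsto> b\<close> shows that it is enough to realise \<open>a\<close>, \<open>b\<close> as the two variables of the free
  algebra. Freeness and the two laws determine \<open>\<phi>\<close>, which is then automatically the positive
  functional given by the free product of \<open>\<mu>\<close> and \<open>\<nu>\<close>, so positivity need not be required.
  The measure \<open>\<rho>\<close> is unique because its support is compact.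
\<close>

definition free_additive_convolution ::
    "real measure \<Rightarrow> real measure \<Rightarrow> real measure \<Rightarrow> bool" where
  "free_additive_convolution \<mu> \<nu> \<rho> \<longleftrightarrow>
     compactly_supported_distribution \<mu> \<and> compactly_supported_distribution \<nu> \<and>
     compactly_supported_distribution \<rho> \<and>
     (\<exists>\<phi>. unital_functional \<phi> \<and>
          freely_independent \<phi> (\<lambda>i. generated_subalgebra (nc_var i)) \<and>
          has_law \<phi> (nc_var False) \<mu> \<and> has_law \<phi> (nc_var True) \<nu> \<and>
          has_law \<phi> (nc_var False + nc_var True) \<rho>)"

end

(* Write G for the Stieltjes transform and s = \<beta>\<^sup>2. Freeness gives the subordination equation
   G_\<rho>(z) = G_\<nu>(W z) with W z = z + s G_\<rho>(z), first as an identity of formal power series at infinity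
   and then, by analytic continuation, on the whole half-line z < supp_minus \<rho>; W cannot reach the
   support of \<nu> there, for otherwise the inverse of W would continue G_\<nu> holomorphically across the
   edge of the support. The logarithmic potential has derivative -G, so
   z \<mapsto> s G_\<rho>(z)\<^sup>2 / 2 + U_\<nu>(W z) has the same derivative and the same asymptotics at -\<infinity> as U_\<rho>.
   It is the value of the objective at g = G_\<rho>(z), where the derivative of the objective in g changes
   sign from negative to positive. *)

theory Submission
  imports Defs "HOL-Complex_Analysis.Complex_Analysis" "HOL-Real_Asymp.Real_Asymp"
begin

unbundle no vec_syntax

section \<open>Power series over the free algebra\<close>

text \<open>A bare linear functional on polynomials offers no norm in which to sum resolvents, so
  they are taken as power series in t = 1/w over the free algebra. There both resolvents are
  rescaled to expectation 1, after Haagerup, which takes the place of cumulants; the semicircle law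
  enters only through the quadratic equation of its moment series. The outcome is parametrised by w
  = W z, not by z: near infinity it reads G_\<rho>(w - s G_\<nu>(w)) = G_\<nu>(w), and it must be
  inverted before it can be continued in z. That continuation looks circular, since it presupposes
  that W z stays left of the support of \<nu>, which is itself proved by continuation. Hence it is
  first carried out only up to a point z0 before which W is known to stay left, and contact at z0 is
  then excluded. The logarithmic term of the objective is concave in g, so convexity does not give
  the minimum. The bound g < g* makes every admissible g a value G_\<rho>(w), and comparing w with z
  gives the sign of the derivative.\<close>

lemma nc_const_mult_lookup: "Poly_Mapping.lookup (nc_const c * x) w = c * Poly_Mapping.lookup x w"
  unfolding nc_const_def mult_map_scale_conv_mult[symmetric]
  by (simp add: Poly_Mapping.map.rep_eq when_def)

lemma nc_const_hom:
  "nc_const 0 = 0" "nc_const 1 = 1" "nc_const (c + d) = nc_const c + nc_const d"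
  "nc_const (c * d) = nc_const c * nc_const d"
  by (simp_all add: nc_const_def single_add mult_single)

lemma nc_const_sum: "nc_const (sum f S) = (\<Sum>i\<in>S. nc_const (f i))"
  by (induction S rule: infinite_finite_induct) (simp_all add: nc_const_hom)

text \<open>A constant is supported on the empty word, so splitting it off on the right leaves
  \<open>w\<close> itself. This makes the scalar series central.\<close>

lemma nc_const_commute: "x * nc_const c = nc_const c * x"
proof (rule poly_mapping_eqI)
  fix w
  have "(\<Sum>q. (c when 0 = q) when w = l + q) = (c when w = l)" for l :: word
  proof -
    have "((c when 0 = q) when w = l + q) = ((c when w = l) when q = 0)" for q
      by (auto simp: when_def)
    then show ?thesis by simp
  qed
  then have "Poly_Mapping.lookup (x * nc_const c) w = (\<Sum>l. (Poly_Mapping.lookup x l * c) when l = w)"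
    by (simp add: nc_const_def lookup_mult lookup_single mult_when eq_commute[of w])
  then show "Poly_Mapping.lookup (x * nc_const c) w = Poly_Mapping.lookup (nc_const c * x) w"
    by (simp add: nc_const_mult_lookup mult.commute)
qed

text \<open>Central coefficients: the formal variable stands for t = 1/w, and complex series in t
  serve as reparametrised points of evaluation.\<close>

definition fps_scalar :: "complex fps \<Rightarrow> nc_poly fps" where
  "fps_scalar c = Abs_fps (\<lambda>n. nc_const (c $ n))"

lemma fps_scalar_nth [simp]: "fps_scalar c $ n = nc_const (c $ n)"
  by (simp add: fps_scalar_def)

lemma fps_scalar_hom:
  "fps_scalar 1 = 1" "fps_scalar (c + d) = fps_scalar c + fps_scalar d"
  "fps_scalar (c * d) = fps_scalar c * fps_scalar d"
  by (simp_all add: fps_eq_iff fps_mult_nth nc_const_sum nc_const_hom)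

lemma fps_scalar_commute: "P * fps_scalar c = fps_scalar c * P"
proof (rule fps_ext)
  fix n
  have "(P * fps_scalar c) $ n = (\<Sum>i=0..n. nc_const (c $ (n - i)) * P $ i)"
    by (simp add: fps_mult_nth nc_const_commute)
  also have "\<dots> = (\<Sum>i=0..n. nc_const (c $ (n - (n - i))) * P $ (n - i))"
    by (subst sum.atLeastAtMost_rev) simp
  also have "\<dots> = (fps_scalar c * P) $ n"
    by (simp add: fps_mult_nth)
  finally show "(P * fps_scalar c) $ n = (fps_scalar c * P) $ n" .
qed

lemma fps_scalar_mult_mult:
  "(fps_scalar c * P) * (fps_scalar d * Q) = fps_scalar (c * d) * (P * Q)"
proof -
  have "(fps_scalar c * P) * (fps_scalar d * Q) = fps_scalar c * (P * fps_scalar d) * Q"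
    by (simp add: mult.assoc)
  also have "\<dots> = fps_scalar (c * d) * (P * Q)"
    by (simp only: fps_scalar_commute[of P d] fps_scalar_hom mult.assoc)
  finally show ?thesis .
qed

definition fps_apply :: "(nc_poly \<Rightarrow> complex) \<Rightarrow> nc_poly fps \<Rightarrow> complex fps" where
  "fps_apply \<phi> P = Abs_fps (\<lambda>n. \<phi> (P $ n))"

text \<open>The series 1/(1 - X). As coefficients do not commute, a one-sided inverse is taken; the
  argument \<open>1\<close> is the inverse of the constant term of \<open>1 - X\<close>.\<close>

definition neumann :: "'a::ring_1 fps \<Rightarrow> 'a fps" where
  "neumann X = fps_right_inverse (1 - X) 1"

lemma neumann_right:
  assumes "X $ 0 = 0"
  shows "(1 - X) * neumann X = 1"
  unfolding neumann_def using assms by (intro fps_right_inverse) simp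

text \<open>Inverses exist on both sides, and associativity identifies them.\<close>

lemma neumann_left:
  assumes "X $ 0 = 0"
  shows "neumann X * (1 - X) = 1"
proof -
  have L: "fps_left_inverse (1 - X) 1 * (1 - X) = 1"
    using assms by (intro fps_left_inverse) simp
  have "fps_left_inverse (1 - X) 1 = fps_left_inverse (1 - X) 1 * ((1 - X) * neumann X)"
    by (simp add: neumann_right assms)
  also have "\<dots> = neumann X"
    using L by (simp add: mult.assoc[symmetric])
  finally show ?thesis using L by simp
qed

lemma neumann_truncate:
  assumes "X $ 0 = 0"
  shows "neumann X = (\<Sum>k\<le>n. X ^ k) + X ^ Suc n * neumann X"
proof (induction n)
  case 0
  show ?case using neumann_right[OF assms] by (simp add: algebra_simps)
next
  case (Suc n)
  have "neumann X = 1 + X * neumann X"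
    using neumann_right[OF assms] by (simp add: algebra_simps)
  then have "X ^ Suc n * neumann X = X ^ Suc n * (1 + X * neumann X)" by simp
  also have "\<dots> = X ^ Suc n + X ^ Suc (Suc n) * neumann X"
    by (simp only: distrib_left power_Suc2 mult.assoc mult_1_right)
  finally show ?case using Suc by (simp add: add.assoc)
qed

lemma fps_power_nth_eq_0:
  fixes X :: "'a::ring_1 fps"
  assumes "X $ 0 = 0" "n < k"
  shows "(X ^ k * Y) $ n = 0"
  using assms(2)
proof (induction k arbitrary: n)
  case (Suc k)
  have "(X * (X ^ k * Y)) $ n = (\<Sum>i=0..n. X $ i * (X ^ k * Y) $ (n - i))"
    by (simp add: fps_mult_nth)
  also have "\<dots> = 0"
  proof (rule sum.neutral, rule ballI)
    fix i assume i: "i \<in> {0..n}"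
    show "X $ i * (X ^ k * Y) $ (n - i) = 0"
    proof (cases "i = 0")
      case False
      with Suc.prems i have "n - i < k" by auto
      then show ?thesis using Suc.IH by simp
    qed (simp add: assms)
  qed
  finally show ?case by (simp add: mult.assoc)
qed simp

lemma neumann_nth:
  assumes "X $ 0 = 0"
  shows "neumann X $ n = (\<Sum>k\<le>n. X ^ k $ n)"
  by (subst neumann_truncate[OF assms, of n], simp only: fps_add_nth fps_sum_nth fps_power_nth_eq_0[OF assms lessI]) simp

text \<open>The push-through identity, a consequence of P (1 - Q P) = (1 - P Q) P.\<close>

lemma neumann_slide:
  assumes "P $ 0 = 0" "Q $ 0 = 0"
  shows "neumann (P * Q) * P = P * neumann (Q * P)"
proof -
  have PQ: "(P * Q) $ 0 = 0" "(Q * P) $ 0 = 0" using assms by simp_all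
  have "neumann (P * Q) * P = neumann (P * Q) * (P * ((1 - Q * P) * neumann (Q * P)))"
    using neumann_right[OF PQ(2)] by simp
  also have "\<dots> = neumann (P * Q) * (1 - P * Q) * P * neumann (Q * P)"
    by (simp add: algebra_simps)
  also have "\<dots> = P * neumann (Q * P)"
    using neumann_left[OF PQ(1)] by simp
  finally show ?thesis .
qed

locale nc_functional =
  fixes \<phi> :: "nc_poly \<Rightarrow> complex"
  assumes unital: "unital_functional \<phi>"
begin

lemma add: "\<phi> (x + y) = \<phi> x + \<phi> y" and scale: "\<phi> (nc_const c * x) = c * \<phi> x" and one: "\<phi> 1 = 1"
  using unital by (auto simp: unital_functional_def)

lemma zero: "\<phi> 0 = 0"
  using add[of 0 0] by simp

lemma sum: "\<phi> (sum f S) = (\<Sum>i\<in>S. \<phi> (f i))"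
  by (induction S rule: infinite_finite_induct) (simp_all add: add zero)

lemma minus: "\<phi> (- x) = - \<phi> x"
  using add[of x "- x"] zero by (simp add: eq_neg_iff_add_eq_0 add.commute)

lemma apply_add: "fps_apply \<phi> (P + Q) = fps_apply \<phi> P + fps_apply \<phi> Q"
  by (simp add: fps_apply_def fps_eq_iff add)

lemma apply_diff: "fps_apply \<phi> (P - Q) = fps_apply \<phi> P - fps_apply \<phi> Q"
  using add[of _ "- _"] by (simp add: fps_apply_def fps_eq_iff minus)

lemma apply_1: "fps_apply \<phi> 1 = 1"
  by (simp add: fps_apply_def fps_eq_iff one zero)

lemma apply_scalar: "fps_apply \<phi> (fps_scalar c * P) = c * fps_apply \<phi> P"
  by (simp add: fps_apply_def fps_eq_iff fps_mult_nth sum scale)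

end

text \<open>With v = 1/z this is z/(z - a) expanded at infinity; v is itself a series because the
  point of evaluation will depend on t.\<close>

definition resolvent :: "complex fps \<Rightarrow> nc_poly \<Rightarrow> nc_poly fps" where
  "resolvent v a = neumann (fps_scalar v * fps_const a)"

text \<open>Since \<open>v ^ k\<close> has order at least k, each coefficient is a polynomial in
  \<open>a\<close>. This places it in the subalgebra generated by \<open>a\<close> and lets the
  functional be evaluated on it.\<close>

lemma resolvent_nth:
  assumes "v $ 0 = 0"
  shows "resolvent v a $ n = (\<Sum>k\<le>n. nc_const (v ^ k $ n) * a ^ k)"
proof -
  have *: "(fps_scalar v * fps_const a) ^ k = fps_scalar (v ^ k) * fps_const (a ^ k)" for k
  proof (induction k)
    case (Suc k)
    then show ?case by (simp add: fps_scalar_mult_mult)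
  qed (simp add: fps_scalar_hom)
  show ?thesis unfolding resolvent_def
    using assms by (subst neumann_nth) (simp_all add: * nc_const_hom)
qed

lemma resolvent_right: "v $ 0 = 0 \<Longrightarrow> (1 - fps_scalar v * fps_const a) * resolvent v a = 1"
  unfolding resolvent_def by (rule neumann_right) (simp add: nc_const_hom)

lemma resolvent_left: "v $ 0 = 0 \<Longrightarrow> resolvent v a * (1 - fps_scalar v * fps_const a) = 1"
  unfolding resolvent_def by (rule neumann_left) (simp add: nc_const_hom)

lemma (in nc_functional) apply_resolvent:
  assumes "v $ 0 = 0"
  shows "fps_apply \<phi> (resolvent v a) = Abs_fps (\<lambda>n. \<phi> (a ^ n)) oo v"
  by (simp add: fps_eq_iff fps_apply_def resolvent_nth[OF assms] fps_compose_nth sum scale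
      atLeast0AtMost mult.commute)

section \<open>Freeness\<close>

lemma generated_subalgebra_add:
  assumes "x \<in> generated_subalgebra a" "y \<in> generated_subalgebra a"
  shows "x + y \<in> generated_subalgebra a"
proof -
  obtain m c n d where x: "x = (\<Sum>k\<le>m. nc_const (c k) * a ^ k)" and y: "y = (\<Sum>k\<le>n. nc_const (d k) * a ^ k)"
    using assms by (auto simp: generated_subalgebra_def)
  define e where "e k = (if k \<le> m then c k else 0) + (if k \<le> n then d k else 0)" for k
  have ext: "(\<Sum>k\<le>m. nc_const (c k) * a ^ k)
      = (\<Sum>k\<le>max m n. nc_const (if k \<le> m then c k else 0) * a ^ k)" for c m n
    by (rule sum.mono_neutral_cong_left) (auto simp: nc_const_hom)
  have "x + y = (\<Sum>k\<le>max m n. nc_const (e k) * a ^ k)"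
    unfolding x y ext[of c m n] ext[of d n m] max.commute[of n m]
    by (simp add: e_def nc_const_hom(3) distrib_right sum.distrib)
  then show ?thesis unfolding generated_subalgebra_def by blast
qed

lemma generated_subalgebra_scale:
  assumes "x \<in> generated_subalgebra a"
  shows "nc_const c * x \<in> generated_subalgebra a"
proof -
  obtain m d where x: "x = (\<Sum>k\<le>m. nc_const (d k) * a ^ k)"
    using assms by (auto simp: generated_subalgebra_def)
  then have "nc_const c * x = (\<Sum>k\<le>m. nc_const (c * d k) * a ^ k)"
    by (simp add: sum_distrib_left nc_const_hom mult.assoc)
  then show ?thesis unfolding generated_subalgebra_def by fast
qed

lemma generated_subalgebra_const: "nc_const c \<in> generated_subalgebra a"
proof -
  have "nc_const c = (\<Sum>k\<le>0. nc_const ((\<lambda>_. c) k) * a ^ k)" by simp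
  then show ?thesis unfolding generated_subalgebra_def mem_Collect_eq by (intro exI conjI TrueI)
qed

lemma generated_subalgebra_sum:
  assumes "\<And>i. i \<in> S \<Longrightarrow> f i \<in> generated_subalgebra a"
  shows "sum f S \<in> generated_subalgebra a"
  using assms
proof (induction S rule: infinite_finite_induct)
  case (insert x F)
  then show ?case by (simp add: generated_subalgebra_add)
qed (use generated_subalgebra_const[of 0 a] in \<open>simp_all add: nc_const_hom\<close>)

lemma one_minus_resolvent_in_generated_subalgebra:
  assumes "v $ 0 = 0"
  shows "(1 - fps_scalar c * resolvent v a) $ n \<in> generated_subalgebra a"
proof -
  have r: "resolvent v a $ n \<in> generated_subalgebra a" for n
    using resolvent_nth[OF assms, of a n] by (force simp: generated_subalgebra_def)
  have "(fps_scalar c * resolvent v a) $ n \<in> generated_subalgebra a"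
    by (auto simp: fps_mult_nth intro!: generated_subalgebra_sum generated_subalgebra_scale r)
  from generated_subalgebra_scale[OF this, of "-1"]
  have "- (fps_scalar c * resolvent v a) $ n \<in> generated_subalgebra a"
    by (simp add: nc_const_def single_uminus)
  moreover have "(1 :: nc_poly fps) $ n \<in> generated_subalgebra a"
    using generated_subalgebra_const[of 0 a] generated_subalgebra_const[of 1 a] by (auto simp: nc_const_hom)
  ultimately have "(1 :: nc_poly fps) $ n + - (fps_scalar c * resolvent v a) $ n \<in> generated_subalgebra a"
    by (intro generated_subalgebra_add)
  then show ?thesis by simp
qed

text \<open>Only the first letter is recorded, because words are extended on the left alone. Closure
  under sums suffices: coefficients of a product of series are sums of products.\<close>

inductive_set alternating :: "(nc_poly \<Rightarrow> complex) \<Rightarrow> ('i \<Rightarrow> nc_poly set) \<Rightarrow> 'i \<Rightarrow> nc_poly set"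
  for \<phi> A i where
  zero: "0 \<in> alternating \<phi> A i"
| add: "x \<in> alternating \<phi> A i \<Longrightarrow> y \<in> alternating \<phi> A i \<Longrightarrow> x + y \<in> alternating \<phi> A i"
| word: "ws \<noteq> [] \<Longrightarrow> fst (hd ws) = i \<Longrightarrow> \<forall>(i, x) \<in> set ws. x \<in> A i \<and> \<phi> x = 0 \<Longrightarrow>
    distinct_adj (map fst ws) \<Longrightarrow> prod_list (map snd ws) \<in> alternating \<phi> A i"

lemma alternating_sum: "(\<And>k. k \<in> S \<Longrightarrow> f k \<in> alternating \<phi> A i) \<Longrightarrow> sum f S \<in> alternating \<phi> A i"
  by (induction S rule: infinite_finite_induct) (auto intro: alternating.intros)

lemma centred_in_alternating: "x \<in> A i \<Longrightarrow> \<phi> x = 0 \<Longrightarrow> x \<in> alternating \<phi> A i"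
  using alternating.word[of "[(i, x)]" i A \<phi>] by simp

lemma centred_mult_alternating:
  assumes "y \<in> alternating \<phi> A j" "x \<in> A i" "\<phi> x = 0" "i \<noteq> j"
  shows "x * y \<in> alternating \<phi> A i"
  using assms(1)
proof induction
  case (word ws)
  have "prod_list (map snd ((i, x) # ws)) \<in> alternating \<phi> A i"
    using word assms(2-4) by (intro alternating.word) (auto simp: distinct_adj_Cons hd_map)
  then show ?case by simp
qed (auto simp: distrib_left intro: alternating.intros)

lemma (in nc_functional) alternating_vanish:
  assumes "freely_independent \<phi> A" "x \<in> alternating \<phi> A i"
  shows "\<phi> x = 0"
  using assms(2)
proof induction
  case (word ws)
  then show ?case using assms(1) unfolding freely_independent_def by blast
qed (simp_all add: zero add)

lemma fps_mult_alternating: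
  assumes "\<And>n. P $ n \<in> A i \<and> \<phi> (P $ n) = 0" "\<And>n. Q $ n \<in> alternating \<phi> A j" "i \<noteq> j"
  shows "(P * Q) $ n \<in> alternating \<phi> A i"
  unfolding fps_mult_nth using assms by (intro alternating_sum centred_mult_alternating) auto

text \<open>For k >= 1 the coefficients of \<open>(P * Q) ^ k\<close> are sums of words alternating
  between the two algebras; subtracting 1 removes the power k = 0.\<close>

lemma neumann_alternating:
  assumes P: "\<And>n. P $ n \<in> A i \<and> \<phi> (P $ n) = 0" and Q: "\<And>n. Q $ n \<in> A j \<and> \<phi> (Q $ n) = 0"
    and "i \<noteq> j" "P $ 0 = 0" "Q $ 0 = 0"
  shows "(neumann (P * Q) - 1) $ n \<in> alternating \<phi> A i"
proof -
  have *: "((P * Q) ^ Suc k) $ n \<in> alternating \<phi> A i" for k n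
  proof (induction k arbitrary: n)
    case 0
    have "(P * Q) $ n \<in> alternating \<phi> A i" for n
      using P Q \<open>i \<noteq> j\<close> by (intro fps_mult_alternating[of P A i \<phi> Q j] centred_in_alternating) auto
    then show ?case by simp
  next
    case (Suc k)
    have "(Q * (P * Q) ^ Suc k) $ n \<in> alternating \<phi> A j" for n
      using Q Suc \<open>i \<noteq> j\<close> by (intro fps_mult_alternating[of Q A j \<phi> _ i]) auto
    then have "(P * (Q * (P * Q) ^ Suc k)) $ n \<in> alternating \<phi> A i" for n
      using P \<open>i \<noteq> j\<close> by (intro fps_mult_alternating[of P A i \<phi> _ j]) auto
    then show ?case by (simp add: mult.assoc)
  qed
  have "(neumann (P * Q) - 1) $ n = (\<Sum>k\<le>n. (P * Q) ^ k $ n) - 1 $ n"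
    using assms by (simp add: neumann_nth)
  also have "{..n} = insert 0 {1..n}" by auto
  also have "(\<Sum>k\<in>insert 0 {1..n}. (P * Q) ^ k $ n) - 1 $ n = (\<Sum>k\<in>{1..n}. (P * Q) ^ k $ n)"
    by (subst sum.insert) (auto simp: fps_one_nth)
  also have "\<dots> \<in> alternating \<phi> A i"
  proof (rule alternating_sum)
    fix k assume "k \<in> {1..n}"
    then show "(P * Q) ^ k $ n \<in> alternating \<phi> A i" using *[of "k - 1" n] by simp
  qed
  finally show ?thesis .
qed

text \<open>Haagerup's observation: the expectation of the resolvent of a sum of free variables can be
  computed from \<open>(1 - y) (1 - x y)\<^sup>-\<^sup>1 (1 - x)\<close>, all of whose nonconstant terms are alternating.\<close>

lemma (in nc_functional) apply_alternating_resolvent: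
  assumes free: "freely_independent \<phi> A"
    and x: "\<And>n. x $ n \<in> A i \<and> \<phi> (x $ n) = 0" and y: "\<And>n. y $ n \<in> A j \<and> \<phi> (y $ n) = 0"
    and ne: "i \<noteq> j" and 0: "x $ 0 = 0" "y $ 0 = 0"
  shows "fps_apply \<phi> ((1 - y) * neumann (x * y) * (1 - x)) = 1"
proof -
  define E where "E = neumann (x * y)"
  define E' where "E' = neumann (y * x)"
  have E: "(E - 1) $ n \<in> alternating \<phi> A i" for n
    unfolding E_def using x y ne 0 by (rule neumann_alternating)
  have E': "(E' - 1) $ n \<in> alternating \<phi> A j" for n
    unfolding E'_def using y x ne[symmetric] 0(2,1) by (rule neumann_alternating)
  have yE: "(y + y * (E - 1)) $ n \<in> alternating \<phi> A j" for n
    unfolding fps_add_nth by (intro alternating.add fps_mult_alternating[OF y E] centred_in_alternating)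
      (use y ne in auto)
  have xE: "(x + x * (E' - 1)) $ n \<in> alternating \<phi> A i" for n
    unfolding fps_add_nth by (intro alternating.add fps_mult_alternating[OF x E'] centred_in_alternating)
      (use x ne in auto)
  have yxE: "(y * (x + x * (E' - 1))) $ n \<in> alternating \<phi> A j" for n
    by (rule fps_mult_alternating[OF y xE]) (use ne in auto)
  \<comment> \<open>Alternation can only be built up on the left, so the trailing factor of
    \<open>E * x\<close> is moved to the front.\<close>
  have slide: "E * x = x + x * (E' - 1)"
    using neumann_slide[OF 0] by (simp add: E_def E'_def algebra_simps)
  have vanish: "fps_apply \<phi> P = 0" if "\<And>n. P $ n \<in> alternating \<phi> A k" for P k
    using alternating_vanish[OF free that] by (simp add: fps_eq_iff fps_apply_def)
  have "(1 - y) * E * (1 - x) = 1 + (E - 1) - (y + y * (E - 1)) - E * x + y * (E * x)"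
    by (simp add: algebra_simps)
  also have "\<dots> = 1 + (E - 1) - (y + y * (E - 1)) - (x + x * (E' - 1)) + y * (x + x * (E' - 1))"
    by (simp only: slide)
  finally show ?thesis
    unfolding E_def[symmetric]
    by (simp only: apply_add[of _ "y * (x + x * (E' - 1))"] apply_add[of 1 "E - 1"]
        apply_diff[of _ "y + y * (E - 1)"] apply_diff[of _ "x + x * (E' - 1)"]
        vanish[OF E] vanish[OF yE] vanish[OF xE] vanish[OF yxE] apply_1) simp
qed

text \<open>This is additivity of the R-transform. With g = t M_b, the quotients q/g = 1/g + s g and
  M_b/g = 1/t are the points where the Cauchy transforms of a and b take the value g, and u/g is
  their sum minus 1/g. The claim M_c(g/u) = u says that the Cauchy transform of a + b is g at
  u/g.\<close>

theorem free_semicircular_convolution_fps: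
  fixes s :: complex and Ma Mb Mc :: "complex fps"
  assumes unital: "unital_functional \<phi>"
    and free: "freely_independent \<phi> (\<lambda>i :: bool. generated_subalgebra (nc_var i))"
    and Ma: "Ma = Abs_fps (\<lambda>n. \<phi> (nc_var False ^ n))"
    and Mb: "Mb = Abs_fps (\<lambda>n. \<phi> (nc_var True ^ n))"
    and Mc: "Mc = Abs_fps (\<lambda>n. \<phi> ((nc_var False + nc_var True) ^ n))"
    and semi: "fps_const s * fps_X ^ 2 * Ma ^ 2 - Ma + 1 = 0"
  shows "Mc oo (fps_X * inverse (1 + fps_const s * fps_X ^ 2 * Mb))
      = Mb * (1 + fps_const s * fps_X ^ 2 * Mb)"
proof -
  interpret nc_functional \<phi> by unfold_locales fact
  define a where "a = nc_var False"
  define b where "b = nc_var True"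
  define g where "g = fps_X * Mb"
  define q where "q = 1 + fps_const s * g ^ 2"
  define u where "u = Mb + fps_const s * g ^ 2"
  define v where "v = g * inverse q"
  define A where "A = fps_scalar (inverse q) * resolvent v a"
  define B where "B = fps_scalar (inverse Mb) * resolvent fps_X b"
  have Mb0: "Mb $ 0 = 1" by (simp add: Mb one)
  have g0: "g $ 0 = 0" by (simp add: g_def)
  have q0: "q $ 0 = 1" by (simp add: q_def g0 fps_power_zeroth)
  have u0: "u $ 0 = 1" by (simp add: u_def g0 Mb0 fps_power_zeroth)
  have v0: "v $ 0 = 0" by (simp add: v_def g0)
  have qi: "q * inverse q = 1" using q0 by (intro inverse_mult_eq_1') simp
  have Mbi: "Mb * inverse Mb = 1" using Mb0 by (intro inverse_mult_eq_1') simp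
  have ui: "u * inverse u = 1" using u0 by (intro inverse_mult_eq_1') simp
  have X0: "fps_X $ 0 = (0::complex)" by simp
  have gv: "g = q * v" using qi by (simp add: v_def mult.left_commute)
  have Mav: "Ma oo v = q"
  proof -
    define f where "f = Ma oo v"
    have f0: "f $ 0 = 1" by (simp add: f_def Ma one)
    have "(fps_const s * fps_X ^ 2 * Ma ^ 2 - Ma + 1) oo v = 0" by (simp add: semi)
    then have f: "fps_const s * v ^ 2 * f ^ 2 - f + 1 = 0"
      by (simp add: fps_compose_add_distrib fps_compose_sub_distrib fps_compose_mult_distrib[OF v0]
          v0 f_def flip: fps_compose_power[OF v0])
    have q: "fps_const s * v ^ 2 * q ^ 2 - q + 1 = 0"
    proof -
      have "fps_const s * v ^ 2 * q ^ 2 = fps_const s * g ^ 2"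
        by (simp add: gv power_mult_distrib)
      then show ?thesis by (simp add: q_def)
    qed
    \<comment> \<open>The quadratic has a unique root here: in the difference of the two equations
      the cofactor of \<open>f - q\<close> has constant term -1, and the series form a
      domain.\<close>
    have "(f - q) * (fps_const s * v ^ 2 * (f + q) - 1)
        = (fps_const s * v ^ 2 * f ^ 2 - f + 1) - (fps_const s * v ^ 2 * q ^ 2 - q + 1)"
      by (simp add: algebra_simps power2_eq_square)
    then have "(f - q) * (fps_const s * v ^ 2 * (f + q) - 1) = 0" using f q by simp
    moreover have "(fps_const s * v ^ 2 * (f + q) - 1) $ 0 = - 1"
      by (simp add: fps_power_zeroth v0)
    then have "fps_const s * v ^ 2 * (f + q) - 1 \<noteq> 0"
      by (metis fps_zero_nth zero_neq_neg_one)
    ultimately have "f - q = 0" by (metis mult_eq_0_iff)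
    then show ?thesis by (simp add: f_def)
  qed
  have phiA: "fps_apply \<phi> A = 1"
    using Mav qi by (simp add: A_def apply_scalar apply_resolvent v0 Ma a_def mult.commute)
  have phiB: "fps_apply \<phi> B = 1"
    using Mbi by (simp add: B_def apply_scalar apply_resolvent Mb b_def mult.commute)
  define W where "W = fps_scalar u - fps_scalar g * fps_const (a + b)"
  have AA: "A * (fps_scalar q - fps_scalar g * fps_const a) = 1"
  proof -
    have "fps_scalar q - fps_scalar g * fps_const a
        = fps_scalar q * (1 - fps_scalar v * fps_const a)"
      by (simp add: gv fps_scalar_hom algebra_simps)
    then show ?thesis
      using qi v0
      by (simp add: A_def fps_scalar_mult_mult resolvent_left mult.commute[of "inverse q"] fps_scalar_hom(1))
  qed
  have BB: "(fps_scalar Mb - fps_scalar g * fps_const b) * B = 1"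
  proof -
    have "fps_scalar Mb - fps_scalar g * fps_const b
        = fps_scalar Mb * (1 - fps_scalar fps_X * fps_const b)"
      by (simp only: g_def fps_scalar_hom(3)[symmetric] right_diff_distrib mult.assoc[symmetric] mult_1_right
          mult.commute[of fps_X])
    then show ?thesis
      using Mbi by (simp add: B_def fps_scalar_mult_mult resolvent_right fps_scalar_hom(1))
  qed
  define x where "x = 1 - A"
  define y where "y = 1 - B"
  have x: "x $ n \<in> generated_subalgebra (nc_var False) \<and> \<phi> (x $ n) = 0" for n
  proof -
    have "fps_apply \<phi> x = 0" unfolding x_def by (simp only: apply_diff apply_1 phiA) simp
    then show ?thesis
      using one_minus_resolvent_in_generated_subalgebra[OF v0]
      by (auto simp: x_def A_def a_def fps_apply_def fps_eq_iff simp del: fps_sub_nth)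
  qed
  have y: "y $ n \<in> generated_subalgebra (nc_var True) \<and> \<phi> (y $ n) = 0" for n
  proof -
    have "fps_apply \<phi> y = 0" unfolding y_def by (simp only: apply_diff apply_1 phiB) simp
    then show ?thesis
      using one_minus_resolvent_in_generated_subalgebra[OF X0]
      by (auto simp: y_def B_def b_def fps_apply_def fps_eq_iff simp del: fps_sub_nth)
  qed
  have x0: "x $ 0 = 0" and y0: "y $ 0 = 0"
    using q0 Mb0 v0 by (simp_all add: x_def y_def A_def B_def resolvent_nth nc_const_hom)
  define E where "E = neumann (x * y)"
  define Wa where "Wa = fps_scalar q - fps_scalar g * fps_const a"
  define Wb where "Wb = fps_scalar Mb - fps_scalar g * fps_const b"
  have W: "W = Wa + Wb - 1"
    by (simp add: W_def Wa_def Wb_def u_def q_def fps_scalar_hom distrib_left flip: fps_const_add)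
  \<comment> \<open>As \<open>A * Wa = 1\<close> and \<open>Wb * B = 1\<close>, the product is B + A
    - A B = 1 - (1 - A)(1 - B).\<close>
  have "A * W * B = (A * Wa) * B + A * (Wb * B) - A * B"
    unfolding W by (simp add: algebra_simps)
  then have AWB: "A * W * B = 1 - x * y"
    unfolding AA[folded Wa_def] BB[folded Wb_def] by (simp add: x_def y_def algebra_simps)
  have BEA: "W * (B * E * A) = 1"
  proof -
    have WaA: "Wa * A = 1"
    proof -
      have "Wa = fps_scalar q * (1 - fps_scalar v * fps_const a)"
        by (simp add: Wa_def gv fps_scalar_hom algebra_simps)
      then show ?thesis
        using qi v0 by (simp add: A_def fps_scalar_mult_mult resolvent_right fps_scalar_hom(1))
    qed
    \<comment> \<open>Inserting \<open>Wa * A = 1\<close> on the left puts W between A and B, where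
      the product is known.\<close>
    have "W * (B * E * A) = Wa * A * W * (B * E * A)" by (simp add: WaA)
    also have "\<dots> = Wa * (A * W * B * E) * A" by (simp add: mult.assoc)
    also have "A * W * B * E = 1"
      unfolding AWB E_def using x0 by (intro neumann_right) simp
    finally show ?thesis by (simp add: WaA)
  qed
  define w where "w = g * inverse u"
  have w0: "w $ 0 = 0" by (simp add: w_def g0)
  define R where "R = fps_scalar (inverse u) * resolvent w (a + b)"
  have gw: "g = u * w" using ui by (simp add: w_def mult.left_commute)
  have RW: "R * W = 1"
  proof -
    have "W = fps_scalar u * (1 - fps_scalar w * fps_const (a + b))"
      unfolding W_def by (simp only: gw fps_scalar_hom right_diff_distrib mult.assoc mult_1_right)
    then show ?thesis
      using ui w0 by (simp add: R_def fps_scalar_mult_mult resolvent_left mult.commute[of "inverse u"] fps_scalar_hom(1))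
  qed
  have "R = R * (W * (B * E * A))" by (simp add: BEA)
  also have "\<dots> = B * E * A" using RW by (simp add: mult.assoc[symmetric])
  also have "B * E * A = (1 - y) * neumann (x * y) * (1 - x)"
    by (simp add: x_def y_def E_def)
  finally have "fps_apply \<phi> R = 1"
    using apply_alternating_resolvent[OF free x y _ x0 y0] by simp
  then have "inverse u * (Mc oo w) = 1"
    by (simp add: R_def apply_scalar apply_resolvent w0 Mc a_def b_def)
  then have "Mc oo w = u"
    using ui by (metis mult.assoc mult.commute mult_1_right)
  moreover have uM: "u = Mb * (1 + fps_const s * fps_X ^ 2 * Mb)"
    by (simp add: u_def g_def algebra_simps power2_eq_square)
  moreover have "w = fps_X * inverse (1 + fps_const s * fps_X ^ 2 * Mb)"
    unfolding w_def uM g_def using Mbi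
    by (simp add: fps_inverse_mult)
  ultimately show ?thesis by simp
qed

section \<open>Moments of the semicircle law\<close>

lemma semicircle_moment_has_integral:
  assumes "\<beta> > 0"
  shows "((\<lambda>x. 1 / (2 * pi * \<beta>\<^sup>2) * sqrt (4 * \<beta>\<^sup>2 - x\<^sup>2) * x ^ n) has_integral (LINT x|semicircle \<beta>. x ^ n))
    {-2*\<beta>..2*\<beta>}"
proof -
  let ?I = "{-2*\<beta>..2*\<beta>}"
  define d where "d x = 1 / (2 * pi * \<beta>\<^sup>2) * sqrt (4 * \<beta>\<^sup>2 - x\<^sup>2)" for x
  have nonneg: "0 \<le> d x * indicator ?I x" for x
  proof (cases "x \<in> ?I")
    case True
    then have "x\<^sup>2 \<le> (2 * \<beta>)\<^sup>2" using \<open>\<beta> > 0\<close> by (intro power2_le_iff_abs_le[THEN iffD2]) auto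
    then show ?thesis using True by (simp add: d_def power_mult_distrib)
  qed simp
  have "(LINT x|semicircle \<beta>. x ^ n) = (LINT x|lborel. (d x * indicator ?I x) *\<^sub>R x ^ n)"
    unfolding semicircle_def d_def[symmetric]
    using nonneg by (intro integral_density) (auto simp: d_def)
  also have "\<dots> = (LINT x:?I|lborel. d x * x ^ n)"
    unfolding set_lebesgue_integral_def by (intro Bochner_Integration.integral_cong) auto
  finally have eq: "(LINT x|semicircle \<beta>. x ^ n) = (LINT x:?I|lborel. d x * x ^ n)" .
  have "set_integrable lborel ?I (\<lambda>x. d x * x ^ n)"
    unfolding d_def by (intro borel_integrable_atLeastAtMost' continuous_intros)
  note I = set_borel_integral_eq_integral[OF this]
  show ?thesis
    using I(1) unfolding eq I(2) d_def[symmetric] by (rule integrable_integral)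
qed

text \<open>Integrate the derivative of x^k (4 \<beta>^2 - x^2)^(3/2), which vanishes at both
  endpoints. The power 3/2 leaves exactly one square root, that of the density. For k = 0 the
  truncated \<open>k - 1\<close> is harmless, its term being multiplied by 0.\<close>

lemma semicircle_moment_recurrence:
  assumes "\<beta> > 0"
  defines "m \<equiv> \<lambda>n. LINT x|semicircle \<beta>. x ^ n"
  shows "4 * \<beta>\<^sup>2 * (real k * m (k - 1)) = real (k + 3) * m (k + 1)"
proof -
  let ?I = "{-2*\<beta>..2*\<beta>}"
  define c where "c = 1 / (2 * pi * \<beta>\<^sup>2)"
  define y where "y x = 4 * \<beta>\<^sup>2 - x\<^sup>2" for x :: real
  define F where "F x = c * (x ^ k * (y x * sqrt (y x)))" for x
  define f where "f x = 4 * \<beta>\<^sup>2 * (real k * (c * sqrt (y x) * x ^ (k - 1)))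
      - real (k + 3) * (c * sqrt (y x) * x ^ (k + 1))" for x
  have "(f has_integral F (2*\<beta>) - F (-2*\<beta>)) ?I"
  proof (rule fundamental_theorem_of_calculus_interior)
    show "- 2 * \<beta> \<le> 2 * \<beta>" using \<open>\<beta> > 0\<close> by simp
    show "continuous_on ?I F"
      unfolding F_def y_def by (intro continuous_intros)
    fix x assume x: "x \<in> {- 2 * \<beta><..<2 * \<beta>}"
    have "\<bar>x\<bar> < 2 * \<beta>" using x by auto
    then have "\<bar>x\<bar>\<^sup>2 < (2 * \<beta>)\<^sup>2" by (intro power_strict_mono) auto
    then have y: "y x > 0" by (simp add: y_def power_mult_distrib)
    have dy: "(y has_real_derivative - 2 * x) (at x)"
      unfolding y_def by (auto intro!: derivative_eq_intros)
    have sq: "sqrt (y x) * sqrt (y x) = y x" using y by simp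
    have "(F has_real_derivative c * (real k * x ^ (k - 1) * (y x * sqrt (y x))
        + x ^ k * ((- 2 * x) * sqrt (y x) + y x * ((- 2 * x) * (inverse (sqrt (y x)) / 2))))) (at x)"
      unfolding F_def using y
      by (auto intro!: derivative_eq_intros dy DERIV_chain'[OF dy DERIV_real_sqrt] simp: field_simps)
    also have "y x * ((- 2 * x) * (inverse (sqrt (y x)) / 2)) = - x * sqrt (y x)"
      using y sq by (simp add: field_simps)
    also have "c * (real k * x ^ (k - 1) * (y x * sqrt (y x)) + x ^ k * ((- 2 * x) * sqrt (y x) + - x * sqrt (y x))) = f x"
      by (cases k) (simp_all add: f_def y_def algebra_simps power2_eq_square)
    finally show "(F has_vector_derivative f x) (at x)"
      by (simp add: has_real_derivative_iff_has_vector_derivative)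
  qed
  then have "(f has_integral 0) ?I"
    by (simp add: F_def y_def power_mult_distrib)
  moreover have "(f has_integral 4 * \<beta>\<^sup>2 * (real k * m (k - 1)) - real (k + 3) * m (k + 1)) ?I"
    unfolding f_def m_def c_def y_def
    by (intro has_integral_diff has_integral_mult_right semicircle_moment_has_integral assms)
  ultimately have "4 * \<beta>\<^sup>2 * (real k * m (k - 1)) - real (k + 3) * m (k + 1) = 0"
    by (rule has_integral_unique[THEN sym])
  then show ?thesis by simp
qed

text \<open>The recurrence is a linear differential equation for \<open>M\<close>; it makes the discriminant
  \<open>(1 - 2 s t\<^sup>2 M)\<^sup>2\<close> of the quadratic equation satisfy the same first order equation as \<open>1 - 4 s t\<^sup>2\<close>.\<close>

lemma catalan_recurrence_imp_quadratic:
  fixes m :: "nat \<Rightarrow> 'a::field_char_0"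
  assumes m0: "m 0 = 1" and rec: "\<And>k. 4 * s * (of_nat k * m (k - 1)) = of_nat (k + 3) * m (k + 1)"
    and "s \<noteq> 0"
  defines "M \<equiv> Abs_fps m"
  shows "fps_const s * fps_X ^ 2 * M ^ 2 - M + 1 = 0"
proof -
  define T where "T = fps_const (4 * s) * fps_X ^ 2"
  define P where "P = 1 - T"
  define D where "D = 1 - fps_const (2 * s) * fps_X ^ 2 * M"
  have ode: "fps_X * fps_deriv M * (1 - T) + (2 - T) * M = 2"
  proof (rule fps_ext)
    fix n
    have "(fps_X * fps_deriv M * (1 - T) + (2 - T) * M) $ n
        = (fps_X * fps_deriv M + 2 * M - fps_const (4 * s) * (fps_X ^ 2 * (fps_X * fps_deriv M + M))) $ n"
      by (simp add: T_def algebra_simps)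
    also have "\<dots> = of_nat n * m n + 2 * m n
        - 4 * s * (if n < 2 then 0 else of_nat (n - 2) * m (n - 2) + m (n - 2))"
    proof (cases "n < 2")
      case True
      then show ?thesis
        by (cases n) (simp_all add: fps_X_power_mult_nth M_def fps_mult_numeral_left fps_numeral_nth)
    next
      case False
      then obtain k where "n = Suc (Suc k)" by (metis add_2_eq_Suc le_Suc_ex not_less)
      then show ?thesis
        by (cases k) (simp_all add: fps_X_power_mult_nth M_def fps_mult_numeral_left)
    qed
    also have "\<dots> = 2 $ n"
    proof -
      \<comment> \<open>Coefficient n is the recurrence at n - 1: n = 1 gives
        \<open>m 1 = 0\<close>, and n = 0 is the normalisation.\<close>
      consider "n = 0" | "n = 1" | k where "n = k + 2"
        by (metis One_nat_def add_2_eq_Suc' not0_implies_Suc)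
      then show ?thesis
      proof cases
        case 2
        have "m 1 = 0" using rec[of 0] by simp
        with 2 show ?thesis by (simp add: fps_numeral_nth)
      next
        case (3 k)
        then show ?thesis using rec[of "k + 1"] by (simp add: fps_numeral_nth algebra_simps)
      qed (simp add: m0)
    qed
    finally show "(fps_X * fps_deriv M * (1 - T) + (2 - T) * M) $ n = 2 $ n" .
  qed
  have dD: "P * fps_deriv D = - (fps_const (4 * s) * fps_X * D)"
  proof -
    have D': "fps_deriv D = - fps_const (4 * s) * fps_X * M - fps_const (2 * s) * fps_X * (fps_X * fps_deriv M)"
      by (simp add: D_def power2_eq_square algebra_simps flip: fps_const_mult fps_const_add numeral_fps_const)
    have "P * fps_deriv D = - fps_const (4 * s) * fps_X * M * P
        - fps_const (2 * s) * fps_X * (fps_X * fps_deriv M * (1 - T))"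
      unfolding D' by (simp add: P_def algebra_simps)
    also have "fps_X * fps_deriv M * (1 - T) = 2 - (2 - T) * M"
      using ode by (simp add: algebra_simps)
    finally show ?thesis
      by (simp add: P_def D_def T_def algebra_simps power2_eq_square flip: fps_const_mult numeral_fps_const)
  qed
  have dP: "fps_deriv P = - fps_const (8 * s) * fps_X"
    by (simp add: P_def T_def power2_eq_square algebra_simps flip: fps_const_mult numeral_fps_const)
  have P0: "P $ 0 = 1" by (simp add: P_def T_def)
  have Pi: "P * inverse P = 1" using P0 by (intro inverse_mult_eq_1') simp
  \<comment> \<open>From P D' = -4 s t D and P' = -8 s t, the series \<open>D ^ 2\<close> and
    \<open>P\<close> have the same logarithmic derivative, so their quotient is constant.\<close>
  have "fps_deriv (D ^ 2 * inverse P) * P ^ 2 = 0"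
  proof -
    have "fps_deriv (D ^ 2 * inverse P) * P ^ 2
      = (2 * D * (P * fps_deriv D)) * (P * inverse P) - D ^ 2 * fps_deriv P * (P * inverse P) ^ 2"
      using P0 by (simp add: fps_inverse_deriv power2_eq_square algebra_simps)
    also have "\<dots> = 0"
      unfolding dD dP Pi by (simp add: power2_eq_square algebra_simps flip: fps_const_mult numeral_fps_const)
    finally show ?thesis .
  qed
  moreover have "P \<noteq> 0" using P0 by auto
  ultimately have "fps_deriv (D ^ 2 * inverse P) = 0" by simp
  then have "D ^ 2 * inverse P = fps_const ((D ^ 2 * inverse P) $ 0)"
    by (simp only: fps_deriv_eq_0_iff)
  also have "\<dots> = 1" using P0 by (simp add: D_def fps_power_zeroth)
  finally have "D ^ 2 * inverse P = 1" .
  moreover have "D ^ 2 = D ^ 2 * inverse P * P"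
    using Pi by (simp add: mult.assoc mult.commute[of "inverse P"])
  ultimately have "D ^ 2 = P" by simp
  \<comment> \<open>The difference \<open>D ^ 2 - P\<close> is T times the quadratic expression, and
    T = 4 s t^2 cancels.\<close>
  then have "T * (fps_const s * fps_X ^ 2 * M ^ 2 - M + 1) = 0"
    by (simp add: P_def D_def T_def algebra_simps power2_eq_square flip: fps_const_mult numeral_fps_const)
  moreover have "T \<noteq> 0" using \<open>s \<noteq> 0\<close> by (simp add: T_def)
  ultimately show ?thesis by simp
qed

section \<open>Transforms of compactly supported distributions\<close>

text \<open>Termwise integration, dominated by C (|d| K)^n. The choice c = f = 1/(x - z) yields
  Taylor series of the transform, and c = 1, f = x yields the moment expansion.\<close>

lemma (in finite_measure) geometric_integral_sums:
  fixes c f :: "'a \<Rightarrow> complex"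
  assumes [measurable]: "c \<in> borel_measurable M" "f \<in> borel_measurable M"
    and c: "AE x in M. norm (c x) \<le> C" and f: "AE x in M. norm (f x) \<le> K"
    and d: "norm d * K < 1" and "0 \<le> K"
  shows "(\<lambda>n. (LINT x|M. c x * f x ^ n) * d ^ n) sums (LINT x|M. c x / (1 - d * f x))"
proof -
  have bound: "AE x in M. norm (c x * (d * f x) ^ n) \<le> C * (norm d * K) ^ n" for n
    using c f
  proof eventually_elim
    case (elim x)
    have "norm (d * f x) \<le> norm d * K"
      using elim by (simp add: norm_mult mult_left_mono)
    then show ?case
      using elim \<open>0 \<le> K\<close> unfolding norm_mult norm_power
      by (intro mult_mono power_mono) (auto simp: norm_mult intro: order_trans[OF norm_ge_zero])
  qed
  have int: "integrable M (\<lambda>x. c x * (d * f x) ^ n)" for n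
    by (rule integrable_const_bound[OF bound]) measurable
  have "(\<lambda>n. LINT x|M. c x * (d * f x) ^ n) sums (LINT x|M. suminf (\<lambda>n. c x * (d * f x) ^ n))"
  proof (rule sums_integral[OF int])
    have geo: "summable (\<lambda>n. C * (norm d * K) ^ n)"
      using d \<open>0 \<le> K\<close> by (intro summable_mult summable_geometric) auto
    have "AE x in M. \<forall>n. norm (c x * (d * f x) ^ n) \<le> C * (norm d * K) ^ n"
      using bound by (simp add: AE_all_countable)
    then show "AE x in M. summable (\<lambda>n. norm (c x * (d * f x) ^ n))"
      by eventually_elim (rule summable_comparison_test'[OF geo], simp)
    show "summable (\<lambda>n. LINT x|M. norm (c x * (d * f x) ^ n))"
    proof (rule summable_comparison_test'[where N = 0])
      show "summable (\<lambda>n. measure M (space M) * (C * (norm d * K) ^ n))"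
        using geo by (rule summable_mult)
      fix n
      have "(LINT x|M. norm (c x * (d * f x) ^ n)) \<le> (LINT x|M. C * (norm d * K) ^ n)"
        using int bound by (intro integral_mono_AE) auto
      then show "norm (LINT x|M. norm (c x * (d * f x) ^ n)) \<le> measure M (space M) * (C * (norm d * K) ^ n)"
        by (simp add: integral_nonneg_AE)
    qed
  qed
  moreover have "(LINT x|M. suminf (\<lambda>n. c x * (d * f x) ^ n)) = (LINT x|M. c x / (1 - d * f x))"
  proof (rule integral_cong_AE)
    show "AE x in M. suminf (\<lambda>n. c x * (d * f x) ^ n) = c x / (1 - d * f x)"
      using f
    proof eventually_elim
      case (elim x)
      have "norm (d * f x) \<le> norm d * K"
        using elim by (simp add: norm_mult mult_left_mono)
      then have "norm (d * f x) < 1" using d by simp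
      then show ?case
        by (subst suminf_mult) (simp_all add: suminf_geometric summable_geometric)
    qed
  qed measurable
  moreover have "(LINT x|M. c x * (d * f x) ^ n) = (LINT x|M. c x * f x ^ n) * d ^ n" for n
    unfolding integral_mult_left_zero[symmetric] by (simp add: power_mult_distrib mult_ac)
  ultimately show ?thesis by simp
qed

locale compact_distribution = real_distribution M for M +
  assumes compact_support: "compact (msupport M)"
begin

abbreviation "m \<equiv> supp_minus M"

text \<open>The complement of the support is a union of open null sets; by Lindelof countably many
  of them suffice.\<close>

lemma AE_msupport: "AE x in M. x \<in> msupport M"
proof -
  define \<F> where "\<F> = {U. open U \<and> emeasure M U = 0}"
  obtain \<F>' where F': "\<F>' \<subseteq> \<F>" "countable \<F>'" "\<Union>\<F>' = \<Union>\<F>"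
    using Lindelof[of \<F>] by (auto simp: \<F>_def)
  have "(\<Union>U\<in>\<F>'. U) \<in> null_sets M"
    using F' by (intro null_sets_UN') (auto simp: \<F>_def null_sets_def)
  then have "AE x in M. x \<notin> \<Union>\<F>"
    using F'(3) by (auto dest: AE_not_in)
  then show ?thesis
    by eventually_elim (auto simp: msupport_def \<F>_def zero_less_iff_neq_zero)
qed

lemma msupport_nonempty: "msupport M \<noteq> {}"
proof
  assume "msupport M = {}"
  with AE_msupport have "AE x in M. False" by simp
  then show False by simp
qed

lemma supp_minus_in_msupport: "m \<in> msupport M"
  unfolding supp_minus_def using msupport_nonempty compact_support
  by (intro closed_contains_Inf) (auto dest: compact_imp_closed compact_imp_bounded bounded_imp_bdd_below)

lemma AE_ge_supp_minus: "AE x in M. m \<le> x"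
  using AE_msupport
proof eventually_elim
  case (elim x)
  then show ?case unfolding supp_minus_def using compact_support
    by (intro cInf_lower) (auto dest: compact_imp_bounded bounded_imp_bdd_below)
qed

lemma AE_bounded: obtains R where "R > 0" "AE x in M. \<bar>x\<bar> \<le> R"
proof -
  obtain R where "R > 0" "\<And>x. x \<in> msupport M \<Longrightarrow> \<bar>x\<bar> \<le> R"
    using compact_imp_bounded[OF compact_support] unfolding bounded_pos by auto
  moreover from this(2) have "AE x in M. \<bar>x\<bar> \<le> R"
    using AE_msupport by (auto elim: eventually_mono)
  ultimately show thesis using that by blast
qed

section \<open>The complex transform on the half-plane left of the support\<close>

definition cstieltjes :: "complex \<Rightarrow> complex" where
  "cstieltjes z = (LINT x|M. 1 / (of_real x - z))"

lemma cstieltjes_of_real: "cstieltjes (of_real z) = of_real (stieltjes M z)"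
proof -
  have "cstieltjes (of_real z) = (LINT x|M. complex_of_real (1 / (x - z)))"
    unfolding cstieltjes_def by (intro Bochner_Integration.integral_cong) auto
  then show ?thesis unfolding stieltjes_def integral_complex_of_real .
qed

text \<open>Expand 1/(x - z - d) geometrically in d/(x - z), using |x - z| >= m - Re z on the
  support.\<close>

lemma cstieltjes_sums:
  assumes "Re z + norm d < m"
  shows "(\<lambda>n. (LINT x|M. (1 / (of_real x - z)) ^ Suc n) * d ^ n) sums cstieltjes (z + d)"
proof -
  have rz: "Re z < m" using assms norm_ge_zero[of d] by linarith
  have le: "AE x in M. norm (1 / (complex_of_real x - z)) \<le> 1 / (m - Re z)"
    using AE_ge_supp_minus
  proof eventually_elim
    case (elim x)
    have "m - Re z \<le> Re (complex_of_real x - z)" using elim by simp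
    also have "\<dots> \<le> norm (complex_of_real x - z)" by (rule complex_Re_le_cmod)
    finally show ?case using rz by (simp add: norm_divide frac_le)
  qed
  have "(\<lambda>n. (LINT x|M. 1 / (of_real x - z) * (1 / (of_real x - z)) ^ n) * d ^ n)
      sums (LINT x|M. 1 / (of_real x - z) / (1 - d * (1 / (of_real x - z))))"
    using rz assms by (intro geometric_integral_sums[OF _ _ le le]) (auto simp: field_simps)
  also have "(LINT x|M. 1 / (of_real x - z) / (1 - d * (1 / (of_real x - z)))) = cstieltjes (z + d)"
    unfolding cstieltjes_def
  proof (rule integral_cong_AE)
    show "AE x in M. 1 / (of_real x - z) / (1 - d * (1 / (of_real x - z))) = 1 / (of_real x - (z + d))"
      using AE_ge_supp_minus
    proof eventually_elim
      case (elim x)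
      then have "of_real x - z \<noteq> 0" using rz by (auto simp: complex_eq_iff)
      then show ?case by (simp add: divide_simps) (simp add: algebra_simps)
    qed
  qed measurable
  finally show ?thesis by simp
qed

lemma cstieltjes_has_fps_expansion:
  assumes "Re z < m"
  shows "(\<lambda>d. cstieltjes (z + d)) has_fps_expansion Abs_fps (\<lambda>n. LINT x|M. (1 / (of_real x - z)) ^ Suc n)"
proof (rule has_fps_expansionI)
  have "\<forall>\<^sub>F d in nhds 0. norm d < m - Re z"
    using assms by (intro order_tendstoD(2)[of _ 0] tendsto_norm_zero filterlim_ident) auto
  then show "\<forall>\<^sub>F d in nhds 0. (\<lambda>n. Abs_fps (\<lambda>n. LINT x|M. (1 / (of_real x - z)) ^ Suc n) $ n * d ^ n)
      sums cstieltjes (z + d)"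
    using cstieltjes_sums[of z] by (auto elim!: eventually_mono)
qed

lemma holomorphic_cstieltjes: "cstieltjes holomorphic_on {z. Re z < m}"
proof -
  have *: "cstieltjes holomorphic_on ball z (m - Re z)" for z
  proof (rule power_series_holomorphic)
    fix w assume "w \<in> ball z (m - Re z)"
    then have "Re z + norm (w - z) < m" by (simp add: dist_norm norm_minus_commute)
    from cstieltjes_sums[OF this]
    show "(\<lambda>n. (LINT x|M. (1 / (of_real x - z)) ^ Suc n) * (w - z) ^ n) sums cstieltjes w" by simp
  qed
  then have "cstieltjes field_differentiable at z" if "Re z < m" for z
    using that by (intro holomorphic_on_imp_differentiable_at[OF *[of z]]) auto
  then show ?thesis
    by (auto simp: holomorphic_on_def field_differentiable_at_within)
qed

text \<open>The derivative is the integral of (x - z)^(-2). Its sign will keep the derivative of z +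
  s G(z) away from 0.\<close>

lemma deriv_cstieltjes_of_real:
  assumes "z < m"
  obtains D where "D \<ge> 0" "(cstieltjes has_field_derivative of_real D) (at (of_real z))"
proof -
  define D where "D = (LINT x|M. (1 / (x - z)) ^ 2)"
  have "D \<ge> 0" unfolding D_def by (rule integral_nonneg_AE) simp
  have "cstieltjes field_differentiable at (of_real z)"
    using holomorphic_cstieltjes by (rule holomorphic_on_imp_differentiable_at)
      (use assms in \<open>auto simp: open_halfspace_Re_lt\<close>)
  then have der: "(cstieltjes has_field_derivative deriv cstieltjes (of_real z)) (at (of_real z))"
    by (simp add: field_differentiable_derivI)
  have "(LINT x|M. (1 / (complex_of_real x - of_real z)) ^ Suc 1) = deriv (\<lambda>d. cstieltjes (of_real z + d)) 0"
    using fps_nth_fps_expansion[OF cstieltjes_has_fps_expansion, of "of_real z" 1] assms by simp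
  also have "\<dots> = deriv cstieltjes (of_real z)"
    using der DERIV_shift[of cstieltjes _ 0 "of_real z"]
    by (intro DERIV_imp_deriv) (simp add: add.commute)
  also have "(LINT x|M. (1 / (complex_of_real x - of_real z)) ^ Suc 1) = (LINT x|M. complex_of_real ((1 / (x - z)) ^ 2))"
    by (intro Bochner_Integration.integral_cong) (auto simp: power2_eq_square)
  also have "\<dots> = of_real D" unfolding integral_complex_of_real D_def ..
  finally show thesis using that \<open>D \<ge> 0\<close> der by simp
qed

text \<open>A local form of Pringsheim's theorem: the Taylor coefficients of the transform to the left of
  the support are nonnegative and at least \<open>p / r\<^sup>n\<^sup>+\<^sup>1\<close> as soon as there is mass \<open>p > 0\<close> within
  distance \<open>r\<close>, so no Taylor series reaches beyond \<open>m\<close>.\<close>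

lemma no_holomorphic_extension:
  assumes F: "F holomorphic_on ball (of_real m) e" and "e > 0"
    and eq: "\<And>w. w \<in> ball (of_real m) e \<Longrightarrow> Re w < m \<Longrightarrow> F w = cstieltjes w"
  shows False
proof -
  \<comment> \<open>The disc of radius 2e/3 about w lies in the e-ball about m, and r = e/2 is below
    2e/3 yet exceeds e/3, the distance from w to m.\<close>
  define w where "w = m - e / 3"
  define r where "r = e / 2"
  have r: "r > 0" "m < w + r" using \<open>e > 0\<close> by (simp_all add: w_def r_def)
  define H where "H d = F (of_real w + d)" for d
  define c where "c n = (LINT x|M. (1 / (x - w)) ^ Suc n)" for n
  have sub: "of_real w + d \<in> ball (of_real m) e" if "norm d < 2 * e / 3" for d :: complex
  proof -
    have "norm (of_real m - (of_real w + d)) = norm (of_real (e / 3) - d)"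
      by (simp add: w_def)
    also have "\<dots> \<le> norm (complex_of_real (e / 3)) + norm d" by (rule norm_triangle_ineq4)
    also have "\<dots> < e" unfolding norm_of_real using that \<open>e > 0\<close> by simp
    finally show ?thesis by (simp add: dist_norm)
  qed
  have holH: "H holomorphic_on ball 0 (2 * e / 3)"
    unfolding H_def
  proof (rule holomorphic_on_compose_gen[OF _ F, unfolded o_def])
    show "(+) (complex_of_real w) ` ball 0 (2 * e / 3) \<subseteq> ball (of_real m) e"
      by (rule image_subsetI, rule sub) simp
  qed (intro holomorphic_intros)
  have "\<forall>\<^sub>F d in nhds 0. norm d < e / 3"
    using \<open>e > 0\<close> by (intro order_tendstoD(2)[of _ 0] tendsto_norm_zero filterlim_ident) auto
  then have "\<forall>\<^sub>F d in nhds 0. H d = cstieltjes (of_real w + d)"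
  proof eventually_elim
    case (elim d)
    have "Re d < e / 3" using elim complex_Re_le_cmod[of d] by linarith
    then show ?case unfolding H_def using elim \<open>e > 0\<close> by (intro eq sub) (auto simp: w_def)
  qed
  then have "(deriv ^^ n) H 0 = (deriv ^^ n) (\<lambda>d. cstieltjes (of_real w + d)) 0" for n
    by (rule higher_deriv_cong_ev) simp
  then have coeff: "(deriv ^^ n) H 0 / fact n = of_real (c n)" for n
  proof -
    have "(LINT x|M. (1 / (complex_of_real x - of_real w)) ^ Suc n) = (LINT x|M. complex_of_real ((1 / (x - w)) ^ Suc n))"
      by (intro Bochner_Integration.integral_cong) auto
    also have "\<dots> = of_real (c n)" unfolding integral_complex_of_real c_def ..
    finally show ?thesis
      using fps_nth_fps_expansion[OF cstieltjes_has_fps_expansion, of "of_real w" n] \<open>e > 0\<close>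
      by (simp add: \<open>(deriv ^^ n) H 0 = _\<close> w_def)
  qed
  have "(\<lambda>n. (deriv ^^ n) H 0 / fact n * (of_real r - 0) ^ n) sums H (of_real r)"
    using holH by (rule holomorphic_power_series) (use r in \<open>auto simp: r_def\<close>)
  then have "(\<lambda>n. complex_of_real (c n * r ^ n)) \<longlonglongrightarrow> of_real 0"
    by (auto simp: coeff dest: sums_summable summable_LIMSEQ_zero)
  then have lim: "(\<lambda>n. c n * r ^ n) \<longlonglongrightarrow> 0"
    by (simp only: tendsto_of_real_iff)
  define p where "p = measure M {..<w + r}"
  have "emeasure M {..<w + r} > 0"
    using supp_minus_in_msupport r unfolding msupport_def by auto
  then have "p > 0" by (simp add: p_def emeasure_eq_measure)
  have "p / r \<le> c n * r ^ n" for n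
  proof -
    have "p * (1 / r) ^ Suc n = (LINT x|M. indicator {..<w + r} x * (1 / r) ^ Suc n)"
      by (simp add: p_def)
    also have "\<dots> \<le> c n"
      unfolding c_def
    proof (rule integral_mono_AE)
      show "integrable M (\<lambda>x. indicator {..<w + r} x * (1 / r) ^ Suc n)" by (rule integrable_const_bound[where B = "(1 / r) ^ Suc n"]) (use r in \<open>auto simp: indicator_def\<close>)
      have w: "w < m" using \<open>e > 0\<close> by (simp add: w_def)
      show "integrable M (\<lambda>x. (1 / (x - w)) ^ Suc n)"
      proof (rule integrable_const_bound[where B = "(1 / (m - w)) ^ Suc n"])
        show "AE x in M. norm ((1 / (x - w)) ^ Suc n) \<le> (1 / (m - w)) ^ Suc n"
          using AE_ge_supp_minus
          by eventually_elim (use w in \<open>simp del: power_Suc add: power_one_over abs_if frac_le power_mono\<close>)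
      qed measurable
      show "AE x in M. indicator {..<w + r} x * (1 / r) ^ Suc n \<le> (1 / (x - w)) ^ Suc n"
        using AE_ge_supp_minus
      proof eventually_elim
        case (elim x)
        show ?case
        proof (cases "x < w + r")
          case True
          then have "1 / r \<le> 1 / (x - w)" using elim w r by (intro frac_le) auto
          then have "(1 / r) ^ Suc n \<le> (1 / (x - w)) ^ Suc n" using r by (intro power_mono) auto
          then show ?thesis using True by simp
        next
          case False
          then show ?thesis using elim w by simp
        qed
      qed
    qed
    finally have "p * (1 / r) ^ Suc n * r ^ n \<le> c n * r ^ n"
      using r by (intro mult_right_mono) auto
    then show ?thesis using r by (simp add: power_one_over)
  qed
  then have "p / r \<le> 0" using lim by (intro LIMSEQ_le_const) auto
  then show False using \<open>p > 0\<close> r by (simp add: field_simps)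
qed

section \<open>The transform on the real line\<close>

lemma AE_kernel_bounds:
  assumes "z < m"
  obtains R where "m \<le> R" "AE x in M. m - z \<le> x - z \<and> x - z \<le> R - z"
proof -
  obtain R where R: "R > 0" "AE x in M. \<bar>x\<bar> \<le> R" by (rule AE_bounded)
  have "AE x in M. m - z \<le> x - z \<and> x - z \<le> R - z"
    using R(2) AE_ge_supp_minus by eventually_elim auto
  moreover from this have "AE x in M. m \<le> R" by eventually_elim auto
  then have "m \<le> R" by simp
  ultimately show thesis using that by blast
qed

lemma integrable_kernel:
  assumes "z < m"
  shows "integrable M (\<lambda>x. 1 / (x - z))"
proof (rule integrable_const_bound[where B = "1 / (m - z)"])
  show "AE x in M. norm (1 / (x - z)) \<le> 1 / (m - z)"
    using AE_ge_supp_minus by eventually_elim (use assms in \<open>auto intro!: frac_le\<close>)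
qed measurable

lemma stieltjes_pos:
  assumes "z < m"
  shows "0 < stieltjes M z"
proof -
  have "(LINT x|M. 0) < stieltjes M z" unfolding stieltjes_def
  proof (rule integral_less_AE_space)
    show "AE x in M. 0 < 1 / (x - z)"
      using AE_ge_supp_minus by eventually_elim (use assms in auto)
  qed (use integrable_kernel[OF assms] emeasure_space_1 in auto)
  then show ?thesis by simp
qed

lemma stieltjes_le:
  assumes "z < m"
  shows "stieltjes M z \<le> 1 / (m - z)"
proof -
  have "stieltjes M z \<le> (LINT x|M. 1 / (m - z))" unfolding stieltjes_def
  proof (rule integral_mono_AE)
    show "AE x in M. 1 / (x - z) \<le> 1 / (m - z)"
      using AE_ge_supp_minus by eventually_elim (use assms in \<open>auto intro!: frac_le\<close>)
  qed (use integrable_kernel[OF assms] in auto)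
  then show ?thesis using prob_space by simp
qed

lemma stieltjes_strict_mono:
  assumes "z < z'" "z' < m"
  shows "stieltjes M z < stieltjes M z'"
  unfolding stieltjes_def
proof (rule integral_less_AE_space)
  show "AE x in M. 1 / (x - z) < 1 / (x - z')"
    using AE_ge_supp_minus by eventually_elim (use assms in \<open>auto intro!: divide_strict_left_mono mult_pos_pos\<close>)
qed (use integrable_kernel assms emeasure_space_1 in auto)

lemma stieltjes_mono: "z \<le> z' \<Longrightarrow> z' < m \<Longrightarrow> stieltjes M z \<le> stieltjes M z'"
  using stieltjes_strict_mono[of z z'] by (cases "z = z'") auto

lemma stieltjes_has_derivative:
  assumes "z < m"
  obtains D where "(stieltjes M has_real_derivative D) (at z)"
proof -
  obtain D where D: "(cstieltjes has_field_derivative of_real D) (at (of_real z))"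
    using deriv_cstieltjes_of_real[OF assms] by blast
  have "((\<lambda>x. cstieltjes (of_real x)) has_vector_derivative of_real D) (at z)"
    by (rule has_vector_derivative_real_field[OF D])
  then have "((\<lambda>x. complex_of_real (stieltjes M x)) has_vector_derivative of_real D) (at z)"
    by (simp only: cstieltjes_of_real)
  then have "((\<lambda>x. Re (complex_of_real (stieltjes M x))) has_vector_derivative Re (of_real D)) (at z)"
    by (rule bounded_linear.has_vector_derivative[OF bounded_linear_Re])
  then show thesis using that by (simp add: has_real_derivative_iff_has_vector_derivative)
qed

lemma isCont_stieltjes: "z < m \<Longrightarrow> isCont (stieltjes M) z"
  by (metis stieltjes_has_derivative DERIV_isCont)

section \<open>The logarithmic potential\<close>

lemma integrable_ln:
  assumes "z < m"
  shows "integrable M (\<lambda>x. ln (x - z))"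
proof -
  obtain R where R: "m \<le> R" "AE x in M. m - z \<le> x - z \<and> x - z \<le> R - z"
    using AE_kernel_bounds[OF assms] by blast
  show ?thesis
  proof (rule integrable_const_bound[where B = "\<bar>ln (m - z)\<bar> + \<bar>ln (R - z)\<bar>"])
    show "AE x in M. norm (ln (x - z)) \<le> \<bar>ln (m - z)\<bar> + \<bar>ln (R - z)\<bar>"
      using R(2)
    proof eventually_elim
      case (elim x)
      then have "ln (m - z) \<le> ln (x - z)" "ln (x - z) \<le> ln (R - z)" using assms by auto
      then show ?case by simp
    qed
  qed measurable
qed

lemma log_potential_eq:
  assumes "z < m"
  shows "log_potential M z = (LINT x|M. ln (x - z))"
  unfolding log_potential_def
proof (rule integral_cong_AE)
  show "AE x in M. ln \<bar>z - x\<bar> = ln (x - z)"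
    using AE_ge_supp_minus by eventually_elim (use assms in auto)
qed measurable

text \<open>Concavity of the logarithm makes \<open>- G\<close> a supergradient of the logarithmic potential.\<close>

lemma log_potential_le_tangent:
  assumes "z < m" "z' < m"
  shows "log_potential M z' \<le> log_potential M z - (z' - z) * stieltjes M z"
proof -
  have "(LINT x|M. ln (x - z')) \<le> (LINT x|M. ln (x - z) - (z' - z) * (1 / (x - z)))"
  proof (rule integral_mono_AE)
    show "AE x in M. ln (x - z') \<le> ln (x - z) - (z' - z) * (1 / (x - z))"
      using AE_ge_supp_minus
    proof eventually_elim
      case (elim x)
      then have "ln (x - z') - ln (x - z) \<le> ((x - z') - (x - z)) / (x - z)"
        using assms by (intro ln_diff_le) auto
      also have "\<dots> = - ((z' - z) * (1 / (x - z)))" by (simp add: diff_divide_distrib)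
      finally show ?case by linarith
    qed
    show "integrable M (\<lambda>x. ln (x - z) - (z' - z) * (1 / (x - z)))"
      by (intro Bochner_Integration.integrable_diff integrable_mult_right integrable_ln integrable_kernel assms)
  qed (rule integrable_ln[OF assms(2)])
  also have "\<dots> = (LINT x|M. ln (x - z)) - (z' - z) * stieltjes M z"
    unfolding stieltjes_def using integrable_ln[OF assms(1)] integrable_kernel[OF assms(1)]
    by (subst Bochner_Integration.integral_diff) (auto simp only: integrable_mult_right integral_mult_right_zero)
  finally show ?thesis using assms by (simp add: log_potential_eq)
qed

text \<open>The tangent inequalities at \<open>z\<close> and at \<open>y\<close> squeeze the
  difference quotient between -G(z) and -G(y), so continuity of G replaces differentiation under the
  integral.\<close>

lemma log_potential_has_derivative:
  assumes "z < m"
  shows "(log_potential M has_real_derivative - stieltjes M z) (at z)"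
  unfolding has_field_derivative_iff
proof (rule LIM_I)
  fix e :: real assume "e > 0"
  then obtain d where d: "d > 0" "\<And>y. \<bar>y - z\<bar> < d \<Longrightarrow> \<bar>stieltjes M y - stieltjes M z\<bar> < e"
    using isCont_stieltjes[OF assms] unfolding continuous_at_eps_delta dist_real_def by blast
  show "\<exists>s>0. \<forall>y. y \<noteq> z \<and> norm (y - z) < s \<longrightarrow>
      norm ((log_potential M y - log_potential M z) / (y - z) - - stieltjes M z) < e"
  proof (intro exI[of _ "min d (m - z)"] conjI allI impI)
    fix y assume y: "y \<noteq> z \<and> norm (y - z) < min d (m - z)"
    then have ym: "y < m" by auto
    define A where "A = log_potential M y - log_potential M z + (y - z) * stieltjes M z"
    have "A \<le> 0" using log_potential_le_tangent[OF assms ym] by (simp add: A_def)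
    moreover have "A \<ge> - ((y - z) * (stieltjes M y - stieltjes M z))"
      using log_potential_le_tangent[OF ym assms] by (simp add: A_def algebra_simps)
    ultimately have "\<bar>A\<bar> \<le> \<bar>y - z\<bar> * \<bar>stieltjes M y - stieltjes M z\<bar>"
      unfolding abs_mult[symmetric] by linarith
    also have "\<dots> < \<bar>y - z\<bar> * e" using y d by (intro mult_strict_left_mono) auto
    finally have "\<bar>A\<bar> / \<bar>y - z\<bar> < e" using y by (simp add: field_simps)
    moreover have "(log_potential M y - log_potential M z) / (y - z) - - stieltjes M z = A / (y - z)"
      using y by (simp add: A_def field_simps)
    ultimately show "norm ((log_potential M y - log_potential M z) / (y - z) - - stieltjes M z) < e"
      by simp
  qed (use d assms in auto)
qed

text \<open>This later fixes the constant of integration.\<close>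

lemma log_potential_asymp: "((\<lambda>z. log_potential M z - ln (- z)) \<longlongrightarrow> 0) at_bot"
proof -
  obtain R where R: "R > 0" "AE x in M. \<bar>x\<bar> \<le> R" by (rule AE_bounded)
  have b: "ln (- z - R) \<le> log_potential M z \<and> log_potential M z \<le> ln (- z + R)" if z: "z < m" "z < - R" for z
  proof
    have "(LINT x|M. ln (- z - R)) \<le> (LINT x|M. ln (x - z))"
    proof (intro integral_mono_AE integrable_ln z)
      show "AE x in M. ln (- z - R) \<le> ln (x - z)"
        using R(2) by eventually_elim (use z in auto)
    qed auto
    then show "ln (- z - R) \<le> log_potential M z" using z prob_space by (simp add: log_potential_eq)
    have "(LINT x|M. ln (x - z)) \<le> (LINT x|M. ln (- z + R))"
    proof (intro integral_mono_AE integrable_ln z)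
      show "AE x in M. ln (x - z) \<le> ln (- z + R)"
        using R(2) AE_ge_supp_minus by eventually_elim (use z in auto)
    qed auto
    then show "log_potential M z \<le> ln (- z + R)" using z prob_space by (simp add: log_potential_eq)
  qed
  have ev: "\<forall>\<^sub>F z in at_bot. z < m \<and> z < - R"
    using eventually_gt_at_bot[of m] eventually_gt_at_bot[of "- R"] by eventually_elim auto
  show ?thesis
  proof (rule tendsto_sandwich)
    show "\<forall>\<^sub>F z in at_bot. ln (- z - R) - ln (- z) \<le> log_potential M z - ln (- z)"
      using ev by eventually_elim (use b in auto)
    show "\<forall>\<^sub>F z in at_bot. log_potential M z - ln (- z) \<le> ln (- z + R) - ln (- z)"
      using ev by eventually_elim (use b in auto)
    show "((\<lambda>z. ln (- z - R) - ln (- z)) \<longlongrightarrow> 0) at_bot" by real_asymp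
    show "((\<lambda>z. ln (- z + R) - ln (- z)) \<longlongrightarrow> 0) at_bot" by real_asymp
  qed
qed

section \<open>Range of the transform and its limit at the edge\<close>

lemma stieltjes_tendsto_0: "(stieltjes M \<longlongrightarrow> 0) at_bot"
proof (rule tendsto_sandwich)
  show "\<forall>\<^sub>F z in at_bot. 0 \<le> stieltjes M z"
    using eventually_gt_at_bot[of m] by eventually_elim (simp add: stieltjes_pos less_imp_le)
  show "\<forall>\<^sub>F z in at_bot. stieltjes M z \<le> 1 / (m - z)"
    using eventually_gt_at_bot[of m] by eventually_elim (rule stieltjes_le)
  show "((\<lambda>z. 1 / (m - z)) \<longlongrightarrow> 0) at_bot" by real_asymp
qed simp

text \<open>Monotonicity turns the one-sided limit into a supremum, so a bound g < g* yields a point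
  where the transform exceeds g.\<close>

lemma g_star_eq_SUP: "g_star M = (SUP z\<in>{..<m}. ereal (stieltjes M z))"
  unfolding g_star_def
proof (rule tendsto_Lim)
  show "((\<lambda>z. ereal (stieltjes M z)) \<longlongrightarrow> (SUP z\<in>{..<m}. ereal (stieltjes M z))) (at_left m)"
  proof (rule order_tendstoI)
    fix a assume "a < (SUP z\<in>{..<m}. ereal (stieltjes M z))"
    then obtain w where w: "w < m" "a < ereal (stieltjes M w)" by (auto simp: less_SUP_iff)
    have "a < ereal (stieltjes M z)" if "w < z" "z < m" for z
      using less_trans[OF w(2)] stieltjes_strict_mono[OF that] by simp
    then show "\<forall>\<^sub>F z in at_left m. a < ereal (stieltjes M z)"
      unfolding eventually_at_left[OF w(1)] using w(1) by blast
  next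
    fix a assume a: "(SUP z\<in>{..<m}. ereal (stieltjes M z)) < a"
    have *: "ereal (stieltjes M z) < a" if "z < m" for z
    proof -
      have "ereal (stieltjes M z) \<le> (SUP z\<in>{..<m}. ereal (stieltjes M z))"
        using that by (intro SUP_upper) simp
      then show ?thesis using a by (rule le_less_trans)
    qed
    have "m - 1 < m" by simp
    then show "\<forall>\<^sub>F z in at_left m. ereal (stieltjes M z) < a"
      unfolding eventually_at_left[OF \<open>m - 1 < m\<close>] using * by blast
  qed
qed (rule trivial_limit_at_left_real)

lemma stieltjes_less_g_star:
  assumes "z < m"
  shows "ereal (stieltjes M z) < g_star M"
proof -
  obtain z' where "z < z'" "z' < m" using dense[OF assms] by blast
  then show ?thesis
    unfolding g_star_eq_SUP using stieltjes_strict_mono[of z z'] by (auto simp: less_SUP_iff)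
qed

lemma stieltjes_surj:
  assumes "0 < g" "ereal g < g_star M"
  obtains z where "z < m" "stieltjes M z = g"
proof -
  obtain w where w: "w < m" "g < stieltjes M w"
    using assms(2) by (auto simp: g_star_eq_SUP less_SUP_iff)
  have "\<forall>\<^sub>F y in at_bot. stieltjes M y < g"
    using stieltjes_tendsto_0 assms(1) by (rule order_tendstoD(2))
  then have "\<forall>\<^sub>F y in at_bot. stieltjes M y < g \<and> y < w"
    using eventually_gt_at_bot[of w] by eventually_elim simp
  from eventually_happens'[OF trivial_limit_at_bot_linorder this]
  obtain y where y: "stieltjes M y < g" "y < w" by blast
  have "\<exists>z. y \<le> z \<and> z \<le> w \<and> stieltjes M z = g"
    using w y by (intro IVT) (auto intro!: isCont_stieltjes)
  then show thesis using that w by (metis le_less_trans)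
qed

section \<open>The moment generating function, that is, the transform near infinity\<close>

definition moment_gf :: "complex \<Rightarrow> complex" where
  "moment_gf t = (LINT x|M. 1 / (1 - t * of_real x))"

lemma moment_gf_has_fps_expansion:
  "moment_gf has_fps_expansion Abs_fps (\<lambda>n. complex_of_real (LINT x|M. x ^ n))"
proof (rule has_fps_expansionI)
  obtain R where R: "R > 0" "AE x in M. \<bar>x\<bar> \<le> R" by (rule AE_bounded)
  have mom: "(LINT x|M. 1 * complex_of_real x ^ n) = complex_of_real (LINT x|M. x ^ n)" for n
    by (simp flip: of_real_power)
  have "\<forall>\<^sub>F t in nhds 0. norm (t :: complex) < 1 / R"
    using R(1) by (intro order_tendstoD(2)[of _ 0] tendsto_norm_zero filterlim_ident) auto
  then show "\<forall>\<^sub>F t in nhds 0. (\<lambda>n. Abs_fps (\<lambda>n. complex_of_real (LINT x|M. x ^ n)) $ n * t ^ n) sums moment_gf t"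
  proof eventually_elim
    case (elim t)
    have "(\<lambda>n. (LINT x|M. 1 * complex_of_real x ^ n) * t ^ n) sums (LINT x|M. 1 / (1 - t * complex_of_real x))"
      using R elim by (intro geometric_integral_sums[where C = 1 and K = R]) (auto simp: field_simps)
    then show ?case by (simp only: mom fps_nth_Abs_fps moment_gf_def)
  qed
qed

lemma cstieltjes_inverse:
  assumes "t \<noteq> 0"
  shows "cstieltjes (1 / t) = - t * moment_gf t"
proof -
  have "1 / (of_real x - 1 / t) = - t * (1 / (1 - t * of_real x))" for x :: real
  proof (cases "1 - t * of_real x = 0")
    \<comment> \<open>At the pole both sides are \<open>1 / 0 = 0\<close>, so the identity holds for
      every real x.\<close>
    case True
    then have "of_real x - 1 / t = 0" using assms by (simp add: field_simps)
    with True show ?thesis by simp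
  next
    case False
    then have "of_real x - 1 / t \<noteq> 0" using assms by (simp add: field_simps)
    with False assms show ?thesis by (simp add: divide_simps) (simp add: algebra_simps)
  qed
  then show ?thesis
    unfolding cstieltjes_def moment_gf_def by (simp only: integral_mult_right_zero)
qed

end

section \<open>Subordination\<close>

text \<open>Makes agreement on a real interval sufficient for the identity theorem.\<close>

lemma of_real_islimpt_of_real_interval:
  assumes "a < y" "y < b"
  shows "(of_real y :: complex) islimpt of_real ` {a<..<b}"
  unfolding islimpt_approachable
proof (intro allI impI)
  fix e :: real assume "e > 0"
  define y' where "y' = max (y - e / 2) ((a + y) / 2)"
  have "a < y'" "y' < y" "y - y' < e" using \<open>e > 0\<close> assms by (auto simp: y'_def max_def field_simps)
  then have "complex_of_real y' \<in> of_real ` {a<..<b}" "complex_of_real y' \<noteq> of_real y"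
      "dist (complex_of_real y') (of_real y) < e"
    using assms by (auto simp: dist_norm simp flip: of_real_diff)
  then show "\<exists>x'\<in>of_real ` {a<..<b}. x' \<noteq> complex_of_real y \<and> dist x' (complex_of_real y) < e"
    by blast
qed

text \<open>The analytic part retains nothing of freeness but this identity of moment series, with s
  the variance of the semicircle law.\<close>

locale semicircular_convolution =
  nu: compact_distribution \<nu> + rho: compact_distribution \<rho> for \<nu> \<rho> :: "real measure" +
  fixes s :: real
  assumes s_pos: "s > 0"
    and moments: "Abs_fps (\<lambda>n. complex_of_real (LINT x|\<rho>. x ^ n))
        oo (fps_X * inverse (1 + fps_const (of_real s) * fps_X ^ 2 * Abs_fps (\<lambda>n. complex_of_real (LINT x|\<nu>. x ^ n))))
      = Abs_fps (\<lambda>n. complex_of_real (LINT x|\<nu>. x ^ n))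
        * (1 + fps_const (of_real s) * fps_X ^ 2 * Abs_fps (\<lambda>n. complex_of_real (LINT x|\<nu>. x ^ n)))"
begin

definition W :: "real \<Rightarrow> real" where
  "W z = z + s * stieltjes \<rho> z"

text \<open>Both sides have the same convergent expansion, so the formal identity becomes one of
  functions near 0.\<close>

lemma moment_gf_eventually:
  "\<forall>\<^sub>F t in nhds 0. rho.moment_gf (t / (1 + of_real s * t ^ 2 * nu.moment_gf t))
      = nu.moment_gf t * (1 + of_real s * t ^ 2 * nu.moment_gf t)"
proof -
  define h where "h = Abs_fps (\<lambda>n. complex_of_real (LINT x|\<nu>. x ^ n))"
  define q where "q = 1 + fps_const (of_real s) * fps_X ^ 2 * h"
  have h: "nu.moment_gf has_fps_expansion h"
    unfolding h_def by (rule nu.moment_gf_has_fps_expansion)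
  have q: "(\<lambda>t. 1 + of_real s * t ^ 2 * nu.moment_gf t) has_fps_expansion q"
    unfolding q_def by (intro fps_expansion_intros h)
  have "(\<lambda>t. t * inverse (1 + of_real s * t ^ 2 * nu.moment_gf t)) has_fps_expansion fps_X * inverse q"
    by (intro has_fps_expansion_mult has_fps_expansion_inverse q has_fps_expansion_fps_X) (simp add: q_def)
  from has_fps_expansion_compose[OF rho.moment_gf_has_fps_expansion this]
  have l: "(\<lambda>t. rho.moment_gf (t / (1 + of_real s * t ^ 2 * nu.moment_gf t))) has_fps_expansion h * q"
    using moments unfolding h_def[symmetric] q_def[symmetric] by (simp add: o_def divide_inverse)
  have r: "(\<lambda>t. nu.moment_gf t * (1 + of_real s * t ^ 2 * nu.moment_gf t)) has_fps_expansion h * q"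
    by (intro has_fps_expansion_mult h q)
  have "\<forall>\<^sub>F t in nhds 0. eval_fps (h * q) t = rho.moment_gf (t / (1 + of_real s * t ^ 2 * nu.moment_gf t))"
    "\<forall>\<^sub>F t in nhds 0. eval_fps (h * q) t = nu.moment_gf t * (1 + of_real s * t ^ 2 * nu.moment_gf t)"
    using l r by (auto simp: has_fps_expansion_def)
  then show ?thesis by eventually_elim simp
qed

text \<open>Put t = 1/w. Since G(1/t) = -t M(t), the inner argument t/q is the reciprocal of w - s
  G_\<nu>(w), and the factor q cancels.\<close>

lemma subordination_at_bot:
  "\<forall>\<^sub>F w in at_bot. stieltjes \<rho> (w - s * stieltjes \<nu> w) = stieltjes \<nu> w"
proof -
  let ?q = "\<lambda>t. 1 + of_real s * t ^ 2 * nu.moment_gf t"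
  have h: "nu.moment_gf has_fps_expansion Abs_fps (\<lambda>n. complex_of_real (LINT x|\<nu>. x ^ n))"
    by (rule nu.moment_gf_has_fps_expansion)
  have "?q has_fps_expansion
      1 + fps_const (of_real s) * fps_X ^ 2 * Abs_fps (\<lambda>n. complex_of_real (LINT x|\<nu>. x ^ n))"
    by (intro fps_expansion_intros h)
  then have "isCont ?q 0" by (rule has_fps_expansion_imp_continuous)
  then have "(?q \<longlongrightarrow> 1) (nhds 0)"
    by (simp add: continuous_at tendsto_nhds_iff)
  then have "\<forall>\<^sub>F t in nhds 0. ?q t \<noteq> 0"
    by (rule tendsto_imp_eventually_ne) simp
  with moment_gf_eventually have "\<forall>\<^sub>F t in nhds 0. ?q t \<noteq> 0 \<and> rho.moment_gf (t / ?q t) = nu.moment_gf t * ?q t"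
    by eventually_elim auto
  moreover have "((\<lambda>w. complex_of_real (1 / w)) \<longlongrightarrow> of_real 0) at_bot"
    by (intro tendsto_of_real) real_asymp
  ultimately have "\<forall>\<^sub>F w in at_bot. ?q (of_real (1 / w)) \<noteq> 0 \<and> rho.moment_gf (of_real (1 / w) / ?q (of_real (1 / w)))
      = nu.moment_gf (of_real (1 / w)) * ?q (of_real (1 / w))"
    by (intro eventually_compose_filterlim[where f = "\<lambda>w. complex_of_real (1 / w)"]) auto
  with eventually_gt_at_bot[of 0] show ?thesis
  proof eventually_elim
    case (elim w)
    define t where "t = complex_of_real (1 / w)"
    have t: "t \<noteq> 0" "1 / t = of_real w" using elim by (auto simp: t_def)
    have q: "?q t \<noteq> 0" and e: "rho.moment_gf (t / ?q t) = nu.moment_gf t * ?q t"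
      using elim by (simp_all add: t_def)
    have nu: "nu.cstieltjes (of_real w) = - t * nu.moment_gf t"
      using nu.cstieltjes_inverse[OF t(1)] t(2) by simp
    have "of_real w - of_real s * nu.cstieltjes (of_real w) = 1 / (t / ?q t)"
      unfolding nu using t q by (simp add: t(2)[symmetric] field_simps power2_eq_square)
    then have "rho.cstieltjes (of_real w - of_real s * nu.cstieltjes (of_real w)) = - (t / ?q t) * rho.moment_gf (t / ?q t)"
      using rho.cstieltjes_inverse[of "t / ?q t"] t q by simp
    also have "\<dots> = nu.cstieltjes (of_real w)"
      unfolding e nu using q by simp
    finally have "rho.cstieltjes (of_real (w - s * stieltjes \<nu> w)) = of_real (stieltjes \<nu> w)"
      by (simp add: nu.cstieltjes_of_real)
    then show ?case by (simp only: rho.cstieltjes_of_real of_real_eq_iff)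
  qed
qed

text \<open>The intermediate value theorem solves w - s G_\<nu>(w) = z far to the left; then
  G_\<rho>(z) = G_\<nu>(w) gives W z = w.\<close>

lemma subordination_initial:
  obtains L where "\<And>z. z \<le> L \<Longrightarrow> W z < supp_minus \<nu> \<and> stieltjes \<rho> z = stieltjes \<nu> (W z)"
proof -
  obtain L where L: "\<And>w. w \<le> L \<Longrightarrow> stieltjes \<rho> (w - s * stieltjes \<nu> w) = stieltjes \<nu> w"
    using subordination_at_bot unfolding eventually_at_bot_linorder by blast
  define w0 where "w0 = min L (supp_minus \<nu> - 1)"
  define f where "f w = w - s * stieltjes \<nu> w" for w
  have f_le: "f w \<le> w" if "w \<le> w0" for w
    using nu.stieltjes_pos[of w] s_pos that by (simp add: f_def w0_def)
  show thesis
  proof (rule that[of "f w0"])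
    fix z assume z: "z \<le> f w0"
    have zw: "z \<le> w0" using z f_le[of w0] by simp
    have "\<exists>w. z \<le> w \<and> w \<le> w0 \<and> f w = z"
    proof (rule IVT)
      \<comment> \<open>Positivity of G_\<nu> lets z itself serve as the left end of the
        interval.\<close>
      show "f z \<le> z" using f_le zw by blast
      show "\<forall>x. z \<le> x \<and> x \<le> w0 \<longrightarrow> isCont f x"
        unfolding f_def w0_def by (intro allI impI continuous_intros nu.isCont_stieltjes) auto
    qed (use z zw in auto)
    then obtain w where w: "w \<le> w0" "f w = z" by blast
    then have "stieltjes \<rho> z = stieltjes \<nu> w" using L[of w] by (simp add: w0_def f_def)
    moreover from this have "W z = w" using w by (simp add: W_def f_def)
    ultimately show "W z < supp_minus \<nu> \<and> stieltjes \<rho> z = stieltjes \<nu> (W z)"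
      using w by (simp add: w0_def)
  qed
qed

section \<open>Analytic continuation of the subordination equation\<close>

definition cW :: "complex \<Rightarrow> complex" where
  "cW z = z + of_real s * rho.cstieltjes z"

lemma cW_of_real: "cW (of_real z) = of_real (W z)"
  by (simp add: cW_def W_def rho.cstieltjes_of_real)

lemma holomorphic_cW: "cW holomorphic_on {z. Re z < supp_minus \<rho>}"
  unfolding cW_def by (intro holomorphic_intros rho.holomorphic_cstieltjes)

text \<open>The bound z0 makes the statement usable twice: up to a hypothetical contact point of W
  with the support of \<nu>, and, once contact is excluded, up to the edge of \<rho>.\<close>

lemma subordination_continuation:
  assumes z0: "z0 \<le> supp_minus \<rho>" and W: "\<And>z. z < z0 \<Longrightarrow> W z < supp_minus \<nu>" and "z < z0"
  shows "stieltjes \<rho> z = stieltjes \<nu> (W z)"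
proof -
  obtain L where L: "\<And>z. z \<le> L \<Longrightarrow> W z < supp_minus \<nu> \<and> stieltjes \<rho> z = stieltjes \<nu> (W z)"
    using subordination_initial by blast
  define S where "S = {z. Re z < supp_minus \<rho>} \<inter> cW -` {w. Re w < supp_minus \<nu>}"
  have "open S" unfolding S_def
    using holomorphic_on_imp_continuous_on[OF holomorphic_cW]
    by (intro continuous_open_preimage) (auto simp: open_halfspace_Re_lt)
  define I where "I = complex_of_real ` {..<z0}"
  have "connected I"
    unfolding I_def by (intro connected_continuous_image continuous_intros) auto
  have "I \<subseteq> S" using W z0 by (auto simp: I_def S_def cW_of_real)
  define a where "a = min L z0 - 1"
  \<comment> \<open>S may be disconnected; the identity theorem is applied in the component
    containing the ray I.\<close>
  define C where "C = connected_component_set S (of_real a)"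
  have aI: "of_real a \<in> I" unfolding I_def by (rule imageI) (simp add: a_def)
  have IC: "I \<subseteq> C"
    unfolding C_def using aI \<open>I \<subseteq> S\<close> \<open>connected I\<close> by (intro connected_component_maximal)
  have CS: "C \<subseteq> S" unfolding C_def by (rule connected_component_subset)
  define f where "f z = rho.cstieltjes z - nu.cstieltjes (cW z)" for z
  have "f (of_real z) = 0"
  proof (rule analytic_continuation[where f = f])
    show "f holomorphic_on C"
      unfolding f_def
    proof (intro holomorphic_intros)
      show "rho.cstieltjes holomorphic_on C"
        using rho.holomorphic_cstieltjes CS by (auto simp: S_def intro: holomorphic_on_subset)
      have "(nu.cstieltjes \<circ> cW) holomorphic_on C"
      proof (rule holomorphic_on_compose_gen[OF _ nu.holomorphic_cstieltjes])
        show "cW holomorphic_on C"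
          using holomorphic_cW CS by (auto simp: S_def intro: holomorphic_on_subset)
      qed (use CS in \<open>auto simp: S_def\<close>)
      then show "(\<lambda>x. nu.cstieltjes (cW x)) holomorphic_on C" by (simp add: o_def)
    qed
    show "open C" "connected C" unfolding C_def using \<open>open S\<close> by (auto intro: open_connected_component)
    have "of_real ` {a - 1<..<a + 1} \<subseteq> I" unfolding I_def by (rule image_mono) (auto simp: a_def)
    then show "of_real ` {a - 1<..<a + 1} \<subseteq> C" using IC by blast
    show "of_real a \<in> C" using aI IC by blast
    show "complex_of_real a islimpt of_real ` {a - 1<..<a + 1}"
      by (rule of_real_islimpt_of_real_interval) auto
    show "of_real z \<in> C" using IC \<open>z < z0\<close> by (auto simp: I_def)
    fix y assume "y \<in> complex_of_real ` {a - 1<..<a + 1}"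
    then obtain x where "y = of_real x" "x \<le> L" by (auto simp: a_def)
    then show "f y = 0"
      using L[of x] by (simp add: f_def cW_of_real rho.cstieltjes_of_real nu.cstieltjes_of_real)
  qed
  then show ?thesis
    by (simp add: f_def cW_of_real rho.cstieltjes_of_real nu.cstieltjes_of_real)
qed

lemma isCont_W: "z < supp_minus \<rho> \<Longrightarrow> isCont W z"
  unfolding W_def by (intro continuous_intros rho.isCont_stieltjes)

lemma W_strict_mono: "z < z' \<Longrightarrow> z' < supp_minus \<rho> \<Longrightarrow> W z < W z'"
  using rho.stieltjes_strict_mono[of z z'] s_pos by (simp add: W_def add_strict_mono)

text \<open>If \<open>W\<close> reached \<open>supp_minus \<nu>\<close> at \<open>z\<^sub>0\<close>, then, as \<open>W' \<ge> 1\<close>, the transform of \<open>\<nu>\<close> would extend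
  holomorphically to a neighbourhood of that point, by \<open>w \<mapsto> (w - W\<^sup>-\<^sup>1 w) / s\<close>.\<close>

lemma W_less:
  assumes "z < supp_minus \<rho>"
  shows "W z < supp_minus \<nu>"
proof (rule ccontr)
  assume "\<not> W z < supp_minus \<nu>"
  then have Wz: "supp_minus \<nu> \<le> W z" by simp
  obtain L where L: "\<And>z. z \<le> L \<Longrightarrow> W z < supp_minus \<nu> \<and> stieltjes \<rho> z = stieltjes \<nu> (W z)"
    using subordination_initial by blast
  have "L \<le> z" using L[of z] Wz by linarith
  then have "\<exists>z0. L \<le> z0 \<and> z0 \<le> z \<and> W z0 = supp_minus \<nu>"
    using L[of L] Wz assms by (intro IVT) (auto intro!: isCont_W)
  then obtain z0 where z0: "z0 \<le> z" "W z0 = supp_minus \<nu>" by blast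
  then have z0r: "z0 < supp_minus \<rho>" using assms by simp
  \<comment> \<open>Strict monotonicity keeps W left of the support before z0, so the conditional
    continuation applies up to there.\<close>
  have eq: "stieltjes \<rho> y = stieltjes \<nu> (W y)" and Wy: "W y < supp_minus \<nu>" if "y < z0" for y
    using subordination_continuation[of z0 y] W_strict_mono[of _ z0] z0 z0r that by auto
  obtain D where D: "D \<ge> 0" "(rho.cstieltjes has_field_derivative of_real D) (at (of_real z0))"
    using rho.deriv_cstieltjes_of_real[OF z0r] by blast
  have "(cW has_field_derivative 1 + of_real s * of_real D) (at (of_real z0))"
    unfolding cW_def by (auto intro!: derivative_eq_intros D)
  then have "deriv cW (of_real z0) = of_real (1 + s * D)" by (simp add: DERIV_imp_deriv)
  moreover have "1 + s * D \<noteq> 0" using D s_pos by (metis add_pos_nonneg less_eq_real_def mult_nonneg_nonneg order_less_irrefl zero_less_one)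
  ultimately have dW: "deriv cW (of_real z0) \<noteq> 0" by (simp only: of_real_eq_0_iff not_False_eq_True)
  obtain r where r: "r > 0" "ball (of_real z0) r \<subseteq> {z. Re z < supp_minus \<rho>}"
      "open (cW ` ball (of_real z0) r)" "inj_on cW (ball (of_real z0) r)"
    using has_complex_derivative_locally_invertible[OF holomorphic_cW _ _ dW] z0r open_halfspace_Re_lt
    by auto
  define V where "V = cW ` ball (complex_of_real z0) r"
  obtain g where g: "g holomorphic_on V" "\<And>z. z \<in> ball (of_real z0) r \<Longrightarrow> g (cW z) = z"
    using holomorphic_has_inverse[OF holomorphic_on_subset[OF holomorphic_cW r(2)] _ r(4)]
    unfolding V_def by (metis open_ball)
  have "of_real (supp_minus \<nu>) \<in> V"
    using z0(2) r(1) cW_of_real[of z0] unfolding V_def by (metis centre_in_ball image_eqI)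
  then obtain e where e: "e > 0" "ball (of_real (supp_minus \<nu>)) e \<subseteq> V"
    using r(3) unfolding V_def by (meson openE)
  define F where "F w = (w - g w) / of_real s" for w
  have holF: "F holomorphic_on ball (of_real (supp_minus \<nu>)) e"
    unfolding F_def using s_pos by (intro holomorphic_intros holomorphic_on_subset[OF g(1) e(2)]) auto
  define H where "H = ball (complex_of_real (supp_minus \<nu>)) e \<inter> {w. Re w < supp_minus \<nu>}"
  \<comment> \<open>The first bound makes each x in the interval a value W u with z0 - r/2 <= u <
    z0, inside the disc where g inverts \<open>cW\<close>; the second keeps x in the e-ball.\<close>
  define a where "a = max (W (z0 - r / 2)) (supp_minus \<nu> - e)"
  define y where "y = (a + supp_minus \<nu>) / 2"
  have a: "a < supp_minus \<nu>" using Wy[of "z0 - r / 2"] r(1) e(1) by (simp add: a_def)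
  have sub: "complex_of_real ` {a<..<supp_minus \<nu>} \<subseteq> H"
    by (auto simp: H_def a_def dist_real_def dist_of_real)
  have "F w = nu.cstieltjes w" if "w \<in> H" for w
  proof -
    have "F w - nu.cstieltjes w = 0"
    proof (rule analytic_continuation[where f = "\<lambda>w. F w - nu.cstieltjes w"])
      show "(\<lambda>w. F w - nu.cstieltjes w) holomorphic_on H"
        by (intro holomorphic_intros holomorphic_on_subset[OF holF]
            holomorphic_on_subset[OF nu.holomorphic_cstieltjes]) (auto simp: H_def)
      show "open H" unfolding H_def by (intro open_Int open_ball open_halfspace_Re_lt)
      show "connected H" unfolding H_def
        by (intro convex_connected convex_Int convex_ball convex_halfspace_Re_lt)
      show "complex_of_real ` {a<..<supp_minus \<nu>} \<subseteq> H" by (rule sub)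
      show "complex_of_real y islimpt of_real ` {a<..<supp_minus \<nu>}"
        using a by (intro of_real_islimpt_of_real_interval) (auto simp: y_def)
      show "complex_of_real y \<in> H" using a by (intro subsetD[OF sub] imageI) (auto simp: y_def)
      show "w \<in> H" by fact
      fix v assume "v \<in> complex_of_real ` {a<..<supp_minus \<nu>}"
      then obtain x where x: "v = of_real x" "a < x" "x < supp_minus \<nu>" by auto
      have "\<exists>u. z0 - r / 2 \<le> u \<and> u \<le> z0 \<and> W u = x"
        using x z0 z0r r(1) by (intro IVT) (auto simp: a_def intro!: isCont_W)
      then obtain u where u: "z0 - r / 2 \<le> u" "u \<le> z0" "W u = x" by blast
      have "u \<noteq> z0" using u x z0 by auto
      with u have uz: "u < z0" by simp
      have "complex_of_real u \<in> ball (of_real z0) r"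
        using u r(1) by (simp add: dist_of_real dist_real_def)
      then have "g v = of_real u" using g(2)[of "of_real u"] by (simp add: cW_of_real u x)
      moreover have "x - u = s * stieltjes \<nu> x" using eq[OF uz] u by (simp add: W_def)
      ultimately have "F v = of_real (stieltjes \<nu> x)"
        using s_pos by (simp add: F_def x flip: of_real_diff of_real_divide)
      then show "F v - nu.cstieltjes v = 0" by (simp add: x nu.cstieltjes_of_real)
    qed
    then show ?thesis by simp
  qed
  with holF e(1) show False by (intro nu.no_holomorphic_extension[of F e]) (auto simp: H_def)
qed

lemma subordination:
  assumes "z < supp_minus \<rho>"
  shows "stieltjes \<rho> z = stieltjes \<nu> (W z)"
  by (rule subordination_continuation[of "supp_minus \<rho>"]) (use assms W_less in auto)

section \<open>The variational formula\<close>

lemma W_at_bot: "filterlim W at_bot at_bot"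
proof (rule filterlim_at_bot_mono)
  show "filterlim (\<lambda>z. z + s) at_bot at_bot" by real_asymp
  have "\<forall>\<^sub>F z in at_bot. stieltjes \<rho> z < 1"
    using rho.stieltjes_tendsto_0 by (rule order_tendstoD(2)) simp
  then show "\<forall>\<^sub>F z in at_bot. W z \<le> z + s"
    by eventually_elim (use s_pos in \<open>simp add: W_def\<close>)
qed

lemma log_potential_subordination:
  assumes "z < supp_minus \<rho>"
  shows "log_potential \<rho> z = s * (stieltjes \<rho> z)\<^sup>2 / 2 + log_potential \<nu> (W z)"
proof -
  let ?S = "{..<supp_minus \<rho>}"
  define D where "D z = s * (stieltjes \<rho> z)\<^sup>2 / 2 + log_potential \<nu> (W z) - log_potential \<rho> z" for z
  have "(D has_real_derivative 0) (at z within ?S)" if "z \<in> ?S" for z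
  proof -
    have z: "z < supp_minus \<rho>" using that by simp
    obtain G' where G': "(stieltjes \<rho> has_real_derivative G') (at z)"
      using rho.stieltjes_has_derivative[OF z] by blast
    have W': "(W has_real_derivative 1 + s * G') (at z)"
      unfolding W_def by (auto intro!: derivative_eq_intros G')
    have "((\<lambda>z. log_potential \<nu> (W z)) has_real_derivative - stieltjes \<nu> (W z) * (1 + s * G')) (at z)"
      by (rule DERIV_chain2[OF nu.log_potential_has_derivative[OF W_less[OF z]] W'])
    then have "(D has_real_derivative s * (2 * stieltjes \<rho> z * G') / 2
        + - stieltjes \<nu> (W z) * (1 + s * G') - - stieltjes \<rho> z) (at z)"
      unfolding D_def
      by (auto intro!: derivative_eq_intros G' rho.log_potential_has_derivative z)
    \<comment> \<open>Subordination replaces G_\<nu>(W z) by G = G_\<rho>(z), leaving s G G' - G (1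
      + s G') + G.\<close>
    also have "s * (2 * stieltjes \<rho> z * G') / 2
        + - stieltjes \<nu> (W z) * (1 + s * G') - - stieltjes \<rho> z = 0"
      by (simp add: subordination[OF z, symmetric] algebra_simps)
    finally show ?thesis by (rule has_field_derivative_at_within)
  qed
  then obtain c where c: "\<And>z. z \<in> ?S \<Longrightarrow> D z = c"
    using has_field_derivative_zero_constant[of ?S D] by auto
  have lnW: "((\<lambda>z. ln (- W z) - ln (- z)) \<longlongrightarrow> 0) at_bot"
  proof (rule Lim_transform_eventually)
    have inv: "((\<lambda>z::real. 1 / z) \<longlongrightarrow> 0) at_bot" by real_asymp
    have "((\<lambda>z. ln (1 + s * stieltjes \<rho> z * (1 / z))) \<longlongrightarrow> ln (1 + s * 0 * 0)) at_bot"
      by (intro tendsto_intros rho.stieltjes_tendsto_0 inv) simp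
    then show "((\<lambda>z. ln (1 + s * stieltjes \<rho> z * (1 / z))) \<longlongrightarrow> 0) at_bot" by simp
    have "\<forall>\<^sub>F z in at_bot. W z < 0"
      using W_at_bot by (simp add: filterlim_at_bot_dense)
    with eventually_gt_at_bot[of 0]
    show "\<forall>\<^sub>F z in at_bot. ln (1 + s * stieltjes \<rho> z * (1 / z)) = ln (- W z) - ln (- z)"
    proof eventually_elim
      case (elim z)
      then have "ln (- W z) - ln (- z) = ln ((- W z) / (- z))"
        by (intro ln_divide_pos[symmetric]) auto
      also have "(- W z) / (- z) = 1 + s * stieltjes \<rho> z * (1 / z)"
        using elim by (simp add: W_def field_simps)
      finally show ?case by simp
    qed
  qed
  \<comment> \<open>D with the two logarithms inserted and removed, so that every summand tends to
    0.\<close>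
  let ?E = "\<lambda>z. s * (stieltjes \<rho> z)\<^sup>2 / 2 + (log_potential \<nu> (W z) - ln (- W z)) + (ln (- W z) - ln (- z))
      - (log_potential \<rho> z - ln (- z))"
  have "(?E \<longlongrightarrow> s * 0\<^sup>2 / 2 + 0 + 0 - 0) at_bot"
    by (intro tendsto_intros rho.stieltjes_tendsto_0 rho.log_potential_asymp lnW
        filterlim_compose[OF nu.log_potential_asymp W_at_bot]) simp
  moreover have "?E = D" by (simp add: D_def fun_eq_iff)
  ultimately have "(D \<longlongrightarrow> 0) at_bot" by simp
  moreover have "(D \<longlongrightarrow> c) at_bot"
    by (rule tendsto_eventually, rule eventually_mono[OF eventually_gt_at_bot[of "supp_minus \<rho>"]]) (simp add: c)
  ultimately have "c = 0" using tendsto_unique trivial_limit_at_bot_linorder by blast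
  then show ?thesis using c[of z] assms by (simp add: D_def)
qed

text \<open>The objective has derivative \<open>s (g - G\<^sub>\<nu> (z + s g))\<close>. Writing \<open>g = G\<^sub>\<rho> w = G\<^sub>\<nu> (w + s g)\<close>, its sign
  is that of \<open>w - z\<close>, by monotonicity of \<open>G\<^sub>\<nu>\<close>.\<close>

lemma objective_minimal:
  assumes z: "z < supp_minus \<rho>" and g: "0 < g" "ereal g < g_star \<rho>" "s * g < supp_minus \<nu> - z"
  shows "log_potential \<rho> z \<le> s * g\<^sup>2 / 2 + log_potential \<nu> (z + s * g)"
proof -
  define \<Phi> where "\<Phi> g = s * g\<^sup>2 / 2 + log_potential \<nu> (z + s * g)" for g
  define g0 where "g0 = stieltjes \<rho> z"
  have g0: "0 < g0" "ereal g0 < g_star \<rho>" "z + s * g0 < supp_minus \<nu>"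
    using z rho.stieltjes_pos rho.stieltjes_less_g_star W_less[OF z] by (auto simp: g0_def W_def)
  have \<Phi>': "(\<Phi> has_real_derivative s * (t - stieltjes \<nu> (z + s * t))) (at t)"
    if t: "z + s * t < supp_minus \<nu>" for t
  proof -
    have "((\<lambda>t. log_potential \<nu> (z + s * t)) has_real_derivative - stieltjes \<nu> (z + s * t) * s) (at t)"
      by (rule DERIV_chain2[where f = "log_potential \<nu>"], rule nu.log_potential_has_derivative[OF t]) (auto intro!: derivative_eq_intros)
    then show ?thesis
      unfolding \<Phi>_def by (auto intro!: derivative_eq_intros simp: algebra_simps)
  qed
  have "\<Phi> g0 \<le> \<Phi> g"
  proof (cases "g0 \<le> g")
    case True
    then show ?thesis
    proof (rule DERIV_nonneg_imp_nondecreasing)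
      fix t assume t: "g0 \<le> t" "t \<le> g"
      \<comment> \<open>Here the bound by g* enters: t is a value of G_\<rho>, at some point
        w.\<close>
      have "ereal t < g_star \<rho>" using t(2) g(2) by (metis ereal_less_eq(3) le_less_trans)
      then obtain w where w: "w < supp_minus \<rho>" "stieltjes \<rho> w = t"
        using rho.stieltjes_surj[of t] t g0 by auto
      have "z \<le> w" using rho.stieltjes_strict_mono[of w z] z w t by (force simp: g0_def)
      have "s * t \<le> s * g" using t s_pos by simp
      have "stieltjes \<nu> (z + s * t) \<le> stieltjes \<nu> (W w)"
        using \<open>z \<le> w\<close> W_less[OF w(1)] w by (intro nu.stieltjes_mono) (auto simp: W_def)
      then have "0 \<le> s * (t - stieltjes \<nu> (z + s * t))"
        using s_pos subordination[OF w(1)] w(2) by simp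
      then show "\<exists>y. (\<Phi> has_real_derivative y) (at t) \<and> 0 \<le> y"
        using \<Phi>'[of t] \<open>s * t \<le> s * g\<close> g(3) by auto
    qed
  next
    case False
    then have "g \<le> g0" by simp
    then show ?thesis
    proof (rule DERIV_nonpos_imp_nonincreasing)
      fix t assume t: "g \<le> t" "t \<le> g0"
      have "ereal t < g_star \<rho>" using t(2) g0(2) by (metis ereal_less_eq(3) le_less_trans)
      then obtain w where w: "w < supp_minus \<rho>" "stieltjes \<rho> w = t"
        using rho.stieltjes_surj[of t] t g by auto
      have "w \<le> z" using rho.stieltjes_strict_mono[of z w] z w t by (force simp: g0_def)
      have "s * t \<le> s * g0" using t s_pos by simp
      then have zt: "z + s * t < supp_minus \<nu>" using g0(3) by linarith
      \<comment> \<open>Now z + s t is the larger argument, kept left of the support through g0; in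
        the other case it was W w.\<close>
      have "stieltjes \<nu> (W w) \<le> stieltjes \<nu> (z + s * t)"
        using \<open>w \<le> z\<close> zt w by (intro nu.stieltjes_mono) (auto simp: W_def)
      then have "s * (t - stieltjes \<nu> (z + s * t)) \<le> 0"
        using s_pos subordination[OF w(1)] w(2) by (simp add: mult_le_0_iff)
      then show "\<exists>y. (\<Phi> has_real_derivative y) (at t) \<and> y \<le> 0"
        using \<Phi>'[OF zt] by auto
    qed
  qed
  moreover have "\<Phi> g0 = log_potential \<rho> z"
    using log_potential_subordination[OF z] by (simp add: \<Phi>_def g0_def W_def)
  ultimately show ?thesis by (simp add: \<Phi>_def)
qed

text \<open>The infimum is attained: G_\<rho>(z) is admissible because W z lies left of the support
  of \<nu> and G_\<rho> is strictly increasing.\<close>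

theorem log_potential_eq_INF:
  assumes z: "z < supp_minus \<rho>"
  shows "ereal (log_potential \<rho> z) =
    (INF g \<in> {g. 0 < g \<and> ereal g < g_star \<rho> \<and> s * g < supp_minus \<nu> - z}.
       ereal (s * g\<^sup>2 / 2 + (LINT l|\<nu>. ln (l - z - s * g))))"
proof -
  have eq: "(LINT l|\<nu>. ln (l - z - s * g)) = log_potential \<nu> (z + s * g)"
    if "s * g < supp_minus \<nu> - z" for g
    using nu.log_potential_eq[of "z + s * g"] that by (simp add: diff_diff_eq)
  show ?thesis
  proof (rule antisym)
    show "ereal (log_potential \<rho> z) \<le> (INF g \<in> {g. 0 < g \<and> ereal g < g_star \<rho> \<and> s * g < supp_minus \<nu> - z}.
       ereal (s * g\<^sup>2 / 2 + (LINT l|\<nu>. ln (l - z - s * g))))"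
      using objective_minimal[OF z] by (intro INF_greatest) (auto simp: eq)
    have g0: "0 < stieltjes \<rho> z" "ereal (stieltjes \<rho> z) < g_star \<rho>" "s * stieltjes \<rho> z < supp_minus \<nu> - z"
      using z rho.stieltjes_pos rho.stieltjes_less_g_star W_less[OF z] by (auto simp: W_def)
    then show "(INF g \<in> {g. 0 < g \<and> ereal g < g_star \<rho> \<and> s * g < supp_minus \<nu> - z}.
       ereal (s * g\<^sup>2 / 2 + (LINT l|\<nu>. ln (l - z - s * g)))) \<le> ereal (log_potential \<rho> z)"
      using log_potential_subordination[OF z]
      by (intro INF_lower2[of "stieltjes \<rho> z"]) (auto simp: eq W_def)
  qed
qed

end

theorem mainTheorem2:
  fixes \<beta> z :: real and \<mu> \<nu> \<rho> :: "real measure"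
  assumes "\<beta> > 0"
    and "\<mu> = semicircle \<beta>"
    and "compactly_supported_distribution \<nu>"
    and "free_additive_convolution \<mu> \<nu> \<rho>"
    and "z < supp_minus \<rho>"
  shows "ereal (log_potential \<rho> z) =
    (INF g \<in> {g :: real. 0 < g \<and> ereal g < g_star \<rho> \<and> \<beta>\<^sup>2 * g < supp_minus \<nu> - z}.
       ereal (\<beta>\<^sup>2 * g\<^sup>2 / 2 + (LINT l|\<nu>. ln (l - z - \<beta>\<^sup>2 * g))))"
proof -
  obtain \<phi> where \<phi>: "unital_functional \<phi>"
      "freely_independent \<phi> (\<lambda>i. generated_subalgebra (nc_var i))"
      "has_law \<phi> (nc_var False) \<mu>" "has_law \<phi> (nc_var True) \<nu>"
      "has_law \<phi> (nc_var False + nc_var True) \<rho>"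
    and dist: "compactly_supported_distribution \<mu>" "compactly_supported_distribution \<nu>"
      "compactly_supported_distribution \<rho>"
    using assms(4) unfolding free_additive_convolution_def by blast
  interpret semi: real_distribution \<mu>
    using dist(1) by (simp add: compactly_supported_distribution_def)
  define ms where "ms n = complex_of_real (LINT x|\<mu>. x ^ n)" for n
  have "4 * complex_of_real (\<beta>\<^sup>2) * (of_nat k * ms (k - 1)) = of_nat (k + 3) * ms (k + 1)" for k
  proof -
    have "complex_of_real (4 * \<beta>\<^sup>2 * (real k * (LINT x|\<mu>. x ^ (k - 1))))
        = complex_of_real (real (k + 3) * (LINT x|\<mu>. x ^ (k + 1)))"
      using semicircle_moment_recurrence[OF \<open>\<beta> > 0\<close>, of k] assms(2) by (simp only:)
    then show ?thesis by (simp only: ms_def of_real_mult of_real_of_nat_eq of_real_numeral)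
  qed
  moreover have "ms 0 = 1" using semi.prob_space by (simp add: ms_def)
  \<comment> \<open>This equation is all that is used of the shape of the semicircle law.\<close>
  ultimately have semi_eq: "fps_const (complex_of_real (\<beta>\<^sup>2)) * fps_X ^ 2 * Abs_fps ms ^ 2 - Abs_fps ms + 1 = 0"
    using \<open>\<beta> > 0\<close> by (intro catalan_recurrence_imp_quadratic) auto
  have cd: "compact_distribution M" if "compactly_supported_distribution M" for M
    using that by (simp add: compactly_supported_distribution_def compact_distribution_def compact_distribution_axioms_def)
  interpret semicircular_convolution \<nu> \<rho> "\<beta>\<^sup>2"
  proof (intro semicircular_convolution.intro semicircular_convolution_axioms.intro cd dist)
    show "Abs_fps (\<lambda>n. complex_of_real (LINT x|\<rho>. x ^ n))
        oo (fps_X * inverse (1 + fps_const (of_real (\<beta>\<^sup>2)) * fps_X ^ 2 * Abs_fps (\<lambda>n. complex_of_real (LINT x|\<nu>. x ^ n))))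
      = Abs_fps (\<lambda>n. complex_of_real (LINT x|\<nu>. x ^ n))
        * (1 + fps_const (of_real (\<beta>\<^sup>2)) * fps_X ^ 2 * Abs_fps (\<lambda>n. complex_of_real (LINT x|\<nu>. x ^ n)))"
      using \<phi>(3-5) semi_eq
      by (intro free_semicircular_convolution_fps[OF \<phi>(1,2)]) (simp_all add: has_law_def ms_def[abs_def])
    show "0 < \<beta>\<^sup>2" using \<open>\<beta> > 0\<close> by simp
  qed
  show ?thesis by (rule log_potential_eq_INF[OF assms(5)])
qed

end
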